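(* Let $F$ be an infinite field with $\operatorname{char} F = 0$ or $\operatorname{char} F \geq n$. Then every $T_{\mathbb{Z}_n}$-ideal $J$ of $\mathcal{L}_{\mathbb{Z}_n}$ with $I \subseteq J$ is finitely generated as a $T_{\mathbb{Z}_n}$-ideal. In other words, the ideal $I$ of $\mathbb{Z}_n$-graded identities of $UT_n(F)^{(-)}$ with its canonical grading has the Specht property.
   Context: $UT_n(F)^{(-)}$ is the Lie algebra of $n\times n$ upper triangular matrices over $F$ with bracket $[a,b]=ab-ba$. Its canonical $\mathbb{Z}_n$-grading is $UT_n(F)^{(-)}=\bigoplus_{k=0}^{n-1}L_k$, where $L_k$ is spanned by the matrix units $e_{ij}$ with $j-i=k$. $\mathcal{L}_{\mathbb{Z}_n}$ is the free Lie algebra over $F$ freely generated by the disjoint countable sets $Y=\{y_1,y_2,\dots\}$ (variables of degree $0$) and $Z^{g}=\{z^{g}_1,z^{g}_2,\dots\}$ for each $g\in\mathbb{Z}_n\setminus\{0\}$ (variables of degree $g$), with the induced $\mathbb{Z}_n$-grading. A $\mathbb{Z}_n$-graded polynomial identity of a graded Lie algebra $A$ is an element of $\mathcal{L}_{\mathbb{Z}_n}$ vanishing under every substitution of its variables by homogeneous elements of $A$ of the same degree. A $T_{\mathbb{Z}_n}$-ideal is a graded ideal of $\mathcal{L}_{\mathbb{Z}_n}$ invariant under all degree-preserving endomorphisms. $I$ denotes the $T_{\mathbb{Z}_n}$-ideal of $\mathbb{Z}_n$-graded identities of $UT_n(F)^{(-)}$ with the canonical grading. A $T_{\mathbb{Z}_n}$-ideal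 has the Specht property if every $T_{\mathbb{Z}_n}$-ideal containing it is finitely generated as a $T_{\mathbb{Z}_n}$-ideal. *)

theory Defs
  imports Main
begin

text \<open>Variables are pairs (g, i): g < n is the Z_n-degree, i the index.
  (0, i) = y_i, (g, i) = z^g_i for 0 < g < n.
  The free associative algebra F<X> is modelled by functions from words to F
  (coefficient of each word); the free Lie algebra L_{Z_n} is the Lie
  subalgebra of F<X> generated by the variables (classical realisation
  of the free Lie algebra over a field).\<close>

type_synonym var = "nat \<times> nat"
type_synonym 'f fa = "var list \<Rightarrow> 'f"

definition fa_mult :: "'f::field fa \<Rightarrow> 'f fa \<Rightarrow> 'f fa" where
  "fa_mult p q = (\<lambda>w. \<Sum>k\<le>length w. p (take k w) * q (drop k w))"

definition fa_one :: "'f::field fa" where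
  "fa_one = (\<lambda>w. if w = [] then 1 else 0)"

definition fa_var :: "var \<Rightarrow> 'f::field fa" where
  "fa_var v = (\<lambda>w. if w = [v] then 1 else 0)"

definition fa_bracket :: "'f::field fa \<Rightarrow> 'f fa \<Rightarrow> 'f fa" where
  "fa_bracket p q = (\<lambda>w. fa_mult p q w - fa_mult q p w)"

inductive_set freeLie :: "nat \<Rightarrow> 'f::field fa set" for n :: nat where
  gen: "g < n \<Longrightarrow> fa_var (g, i) \<in> freeLie n"
| add: "p \<in> freeLie n \<Longrightarrow> q \<in> freeLie n \<Longrightarrow> (\<lambda>w. p w + q w) \<in> freeLie n"
| smult: "p \<in> freeLie n \<Longrightarrow> (\<lambda>w. c * p w) \<in> freeLie n"
| bracket: "p \<in> freeLie n \<Longrightarrow> q \<in> freeLie n \<Longrightarrow> fa_bracket p q \<in> freeLie n"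

definition wdeg :: "nat \<Rightarrow> var list \<Rightarrow> nat" where
  "wdeg n w = (sum_list (map fst w)) mod n"

definition homog :: "nat \<Rightarrow> nat \<Rightarrow> 'f::field fa \<Rightarrow> bool" where
  "homog n g p \<longleftrightarrow> (\<forall>w. p w \<noteq> 0 \<longrightarrow> wdeg n w = g)"

definition comp :: "nat \<Rightarrow> nat \<Rightarrow> 'f::field fa \<Rightarrow> 'f fa" where
  "comp n g p = (\<lambda>w. if wdeg n w = g then p w else 0)"

definition word_prod :: "(var \<Rightarrow> 'f::field fa) \<Rightarrow> var list \<Rightarrow> 'f fa" where
  "word_prod \<sigma> w = foldr (\<lambda>v q. fa_mult (\<sigma> v) q) w fa_one"

definition fsubst :: "(var \<Rightarrow> 'f::field fa) \<Rightarrow> 'f fa \<Rightarrow> 'f fa" where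
  "fsubst \<sigma> p = (\<lambda>u. \<Sum>w | p w \<noteq> 0. p w * word_prod \<sigma> w u)"

definition graded_endo :: "nat \<Rightarrow> (var \<Rightarrow> 'f::field fa) \<Rightarrow> bool" where
  "graded_endo n \<sigma> \<longleftrightarrow> (\<forall>g i. g < n \<longrightarrow> \<sigma> (g, i) \<in> freeLie n \<and> homog n g (\<sigma> (g, i)))"

text \<open>n x n matrices over F, as functions nat => nat => F (entries with indices < n).\<close>
type_synonym 'f mat = "nat \<Rightarrow> nat \<Rightarrow> 'f"

definition mmult :: "nat \<Rightarrow> 'f::field mat \<Rightarrow> 'f mat \<Rightarrow> 'f mat" where
  "mmult n A B = (\<lambda>i j. \<Sum>k<n. A i k * B k j)"

definition mone :: "nat \<Rightarrow> 'f::field mat" where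
  "mone n = (\<lambda>i j. if i = j \<and> i < n then 1 else 0)"

definition UT_comp :: "nat \<Rightarrow> nat \<Rightarrow> 'f::field mat \<Rightarrow> bool" where
  "UT_comp n k A \<longleftrightarrow> (\<forall>i j. A i j \<noteq> 0 \<longrightarrow> i < n \<and> j < n \<and> j = i + k)"

definition word_eval :: "nat \<Rightarrow> (var \<Rightarrow> 'f::field mat) \<Rightarrow> var list \<Rightarrow> 'f mat" where
  "word_eval n \<phi> w = foldr (\<lambda>v M. mmult n (\<phi> v) M) w (mone n)"

text \<open>Evaluation of a Lie polynomial in UT_n(F)^(-) (computed via the associative
  envelope F<X> -> UT_n(F), which agrees with the Lie evaluation).\<close>
definition meval :: "nat \<Rightarrow> (var \<Rightarrow> 'f::field mat) \<Rightarrow> 'f fa \<Rightarrow> 'f mat" where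
  "meval n \<phi> p = (\<lambda>i j. \<Sum>w | p w \<noteq> 0. p w * word_eval n \<phi> w i j)"

definition graded_identity :: "nat \<Rightarrow> 'f::field fa \<Rightarrow> bool" where
  "graded_identity n f \<longleftrightarrow> f \<in> freeLie n \<and>
     (\<forall>\<phi>. (\<forall>g i. g < n \<longrightarrow> UT_comp n g (\<phi> (g, i))) \<longrightarrow> (\<forall>i j. meval n \<phi> f i j = 0))"

definition IdUT :: "nat \<Rightarrow> 'f::field fa set" where
  "IdUT n = {f. graded_identity n f}"

definition T_ideal :: "nat \<Rightarrow> 'f::field fa set \<Rightarrow> bool" where
  "T_ideal n J \<longleftrightarrow> J \<subseteq> freeLie n \<and> (\<lambda>w. 0) \<in> J
     \<and> (\<forall>p\<in>J. \<forall>q\<in>J. (\<lambda>w. p w + q w) \<in> J)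
     \<and> (\<forall>p\<in>J. \<forall>c. (\<lambda>w. c * p w) \<in> J)
     \<and> (\<forall>p\<in>J. \<forall>q\<in>freeLie n. fa_bracket p q \<in> J)
     \<and> (\<forall>p\<in>J. \<forall>g<n. comp n g p \<in> J)
     \<and> (\<forall>\<sigma>. graded_endo n \<sigma> \<longrightarrow> (\<forall>p\<in>J. fsubst \<sigma> p \<in> J))"

definition T_gen :: "nat \<Rightarrow> 'f::field fa set \<Rightarrow> 'f fa set" where
  "T_gen n S = \<Inter>{K. T_ideal n K \<and> S \<subseteq> K}"

end

theory Submission
  imports Defs
    "HOL-Library.Multiset_Order"
    "HOL-Library.Product_Lexorder"
    "HOL-Library.Sublist"
    "HOL-Library.Infinite_Set"
    "HOL-Library.Function_Algebras"
    "HOL-Computational_Algebra.Polynomial"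
begin

text \<open>
  Let \<open>K\<close> be the T-ideal generated by \<open>[y\<^sub>1, y\<^sub>2]\<close> and the \<open>[z\<^sup>g, z\<^sup>h]\<close> with \<open>g + h \<ge> n\<close>;
  it lies in \<open>I\<close>, and already every T-ideal \<open>J\<close> above \<open>K\<close> is finitely generated. Modulo \<open>K\<close> the free
  Lie algebra is spanned by the \<open>y\<^sub>i\<close> and by left-normed brackets of elements
  \<open>[z, y\<^sub>i, \<dots>, y\<^sub>j]\<close>, in which the \<open>y\<close>'s may be permuted and which vanish once the sum of the
  degrees of the \<open>z\<close>'s reaches \<open>n\<close>. So each \<open>z\<close> occurs fewer than \<open>n\<close> times, and since this number
  is invertible in \<open>F\<close>, \<open>J\<close> is determined by its elements that are multilinear in the \<open>z\<close>'s; up to renaming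
  there are finitely many choices of these \<open>z\<close>'s. For a fixed choice \<open>z\<^sub>1, \<dots>, z\<^sub>k\<close> the multilinear elements
  modulo \<open>K\<close> form a quotient of a free module of finite rank over the polynomial ring in the variables
  \<open>y\<^sub>i\<^sup>(\<^sup>j\<^sup>)\<close>, where multiplication by \<open>y\<^sub>i\<^sup>(\<^sup>j\<^sup>)\<close> is the substitution \<open>z\<^sub>j \<mapsto> [z\<^sub>j, y\<^sub>i]\<close>, and the
  substitutions \<open>y\<^sub>i \<mapsto> y\<^bsub>\<pi>(i)\<^esub>\<close> with \<open>\<pi>\<close> strictly increasing act as well. By Cohen's theorem, a
  Groebner basis argument resting on Higman's lemma, such modules are Noetherian up to this action.
\<close>

section \<open>Higman's lemma and Dickson's lemma\<close>

text \<open>The indices in \<open>M\<close>, after which the sequence never drops below its value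
  there, are infinite in number: every tail attains its minimum, and a place where it does lies in
  \<open>M\<close>.\<close>

lemma nat_seq_mono_subseq:
  fixes f :: "nat \<Rightarrow> nat"
  obtains r :: "nat \<Rightarrow> nat" where "strict_mono r" "\<And>i j. i < j \<Longrightarrow> f (r i) \<le> f (r j)"
proof -
  define M where "M = {i. \<forall>j>i. f i \<le> f j}"
  have "infinite M"
    unfolding infinite_nat_iff_unbounded_le
  proof
    fix k
    obtain i where "k \<le> i" "\<And>j. k \<le> j \<Longrightarrow> f i \<le> f j"
      using ex_has_least_nat[of "\<lambda>i. k \<le> i" k f] by auto
    then show "\<exists>i\<ge>k. i \<in> M" unfolding M_def by fastforce
  qed
  then have "strict_mono (enumerate M)" "\<And>i. enumerate M i \<in> M"
    by (auto simp: strict_mono_enumerate enumerate_in_set)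
  then show thesis
    using that[of "enumerate M"] by (auto simp: M_def strict_mono_def)
qed

text \<open>Coordinates are treated one at a time by thinning the subsequence; thinning keeps the
  earlier coordinates monotone.\<close>

lemma dickson_subseq:
  fixes f :: "nat \<Rightarrow> 'a \<Rightarrow> nat"
  assumes "finite V"
  shows "\<exists>r :: nat \<Rightarrow> nat. strict_mono r \<and> (\<forall>i j. i < j \<longrightarrow> (\<forall>v\<in>V. f (r i) v \<le> f (r j) v))"
  using assms
proof (induction V rule: finite_induct)
  case empty
  show ?case by (intro exI[of _ id]) (auto simp: strict_mono_def)
next
  case (insert x V)
  then obtain r :: "nat \<Rightarrow> nat" where r: "strict_mono r" "\<And>i j v. i < j \<Longrightarrow> v \<in> V \<Longrightarrow> f (r i) v \<le> f (r j) v"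
    by blast
  obtain s :: "nat \<Rightarrow> nat" where s: "strict_mono s" "\<And>i j. i < j \<Longrightarrow> f (r (s i)) x \<le> f (r (s j)) x"
    using nat_seq_mono_subseq[of "\<lambda>i. f (r i) x"] by blast
  show ?case
    using r s by (intro exI[of _ "\<lambda>i. r (s i)"]) (auto simp: strict_mono_def)
qed

section \<open>Minimal bad sequences\<close>

context
  fixes P :: "'a \<Rightarrow> 'a \<Rightarrow> bool"
begin

definition bad_seq :: "(nat \<Rightarrow> 'a list) \<Rightarrow> bool" where
  "bad_seq f \<longleftrightarrow> (\<forall>i j. i < j \<longrightarrow> \<not> list_emb P (f i) (f j))"

definition bad_prefix :: "'a list list \<Rightarrow> bool" where
  "bad_prefix xs \<longleftrightarrow> (\<exists>f. bad_seq f \<and> map f [0..<length xs] = xs)"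

text \<open>Each choice depends on all earlier ones, so the recursion carries the whole prefix;
  \<open>arg_min\<close> chooses meaningfully only while the prefix extends to a bad
  sequence.\<close>

primrec min_bad :: "nat \<Rightarrow> 'a list list" where
  "min_bad 0 = []"
| "min_bad (Suc n) = min_bad n @ [arg_min length (\<lambda>x. bad_prefix (min_bad n @ [x]))]"

lemma length_min_bad [simp]: "length (min_bad n) = n"
  by (induction n) auto

lemma bad_prefix_extend:
  assumes "bad_prefix xs"
  shows "\<exists>x. bad_prefix (xs @ [x])"
proof -
  obtain f where "bad_seq f" "map f [0..<length xs] = xs"
    using assms by (auto simp: bad_prefix_def)
  then have "bad_prefix (xs @ [f (length xs)])"
    by (auto simp: bad_prefix_def intro!: exI[of _ f])
  then show ?thesis ..
qed

lemma min_bad_arg_min: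
  assumes "bad_seq f"
  shows "bad_prefix (min_bad n)"
    and "bad_prefix (min_bad n @ [x]) \<Longrightarrow> length (last (min_bad (Suc n))) \<le> length x"
proof -
  have *: "bad_prefix (min_bad n @ [arg_min length (\<lambda>x. bad_prefix (min_bad n @ [x]))])"
    if "bad_prefix (min_bad n)" for n
    using bad_prefix_extend[OF that] by (auto intro: arg_min_natI)
  show "bad_prefix (min_bad n)"
    by (induction n) (use assms * in \<open>auto simp: bad_prefix_def\<close>)
  show "length (last (min_bad (Suc n))) \<le> length x" if "bad_prefix (min_bad n @ [x])"
    using that by (auto intro: arg_min_nat_le)
qed

lemma min_bad_nth: "i < n \<Longrightarrow> min_bad n ! i = last (min_bad (Suc i))"
proof (induction n)
  case (Suc n)
  then show ?case by (cases "i = n") (auto simp: nth_append)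
qed simp

text \<open>Nash-Williams' minimal bad sequence argument.\<close>

theorem higman:
  fixes f :: "nat \<Rightarrow> 'a list"
  assumes sub: "\<And>h :: nat \<Rightarrow> 'a. 
      \<exists>r :: nat \<Rightarrow> nat. strict_mono r \<and> (\<forall>i j. i < j \<longrightarrow> P (h (r i)) (h (r j)))"
  shows "\<exists>i j. i < j \<and> list_emb P (f i) (f j)"
proof (rule ccontr)
  assume "\<not> ?thesis"
  then have f: "bad_seq f" by (auto simp: bad_seq_def)
  define m where "m i = last (min_bad (Suc i))" for i
  \<comment> \<open>Any two entries of the limit \<open>m\<close> already occur in a finite prefix,
    which some bad sequence shares.\<close>
  have m: "bad_seq m"
    unfolding bad_seq_def
  proof (intro allI impI notI)
    fix i j :: nat
    assume ij: "i < j" "list_emb P (m i) (m j)"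
    obtain g where g: "bad_seq g" "map g [0..<Suc j] = min_bad (Suc j)"
      using min_bad_arg_min(1)[OF f, of "Suc j"] unfolding bad_prefix_def by auto
    have "g k = m k" if "k < Suc j" for k
      using min_bad_nth[OF that] arg_cong[OF g(2), of "\<lambda>xs. xs ! k"] that
      by (simp add: m_def del: upt_Suc min_bad.simps)
    then have "g i = m i" "g j = m j" using ij(1) by auto
    with ij g(1) show False
      unfolding bad_seq_def by metis
  qed
  have ne: "m i \<noteq> []" for i
    using m unfolding bad_seq_def by (metis lessI list_emb_Nil)
  define h where "h i = hd (m i)" for i
  define t where "t i = tl (m i)" for i
  have mht: "m i = h i # t i" for i
    using ne by (simp add: h_def t_def)
  obtain r :: "nat \<Rightarrow> nat" where r: "strict_mono r" "\<And>i j. i < j \<Longrightarrow> P (h (r i)) (h (r j))"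
    using sub[of h] by auto
  \<comment> \<open>The competitor: follow \<open>m\<close> up to the index \<open>r 0\<close>, then
    continue with the tails along the subsequence whose heads are related by
    \<open>P\<close>.\<close>
  define g where "g i = (if i < r 0 then m i else t (r (i - r 0)))" for i
  have rr: "r 0 \<le> r i" for i
    using r(1) by (simp add: strict_mono_less_eq)
  have "bad_seq g"
    unfolding bad_seq_def
  proof (intro allI impI notI)
    fix i j :: nat
    assume ij: "i < j" and e: "list_emb P (g i) (g j)"
    consider "j < r 0" | "i < r 0" "r 0 \<le> j" | "r 0 \<le> i" by linarith
    then show False
    proof cases
      case 1
      then show False using m ij e by (auto simp: g_def bad_seq_def)
    next
      case 2
      then have "list_emb P (m i) (m (r (j - r 0)))"
        using e by (auto simp: g_def mht[of "r (j - r 0)"])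
      moreover have "i < r (j - r 0)" using 2 rr[of "j - r 0"] by linarith
      ultimately show False using m by (auto simp: bad_seq_def)
    next
      case 3
      then have "i - r 0 < j - r 0" using ij by linarith
      then have "r (i - r 0) < r (j - r 0)" "P (h (r (i - r 0))) (h (r (j - r 0)))"
        using r by (auto simp: strict_mono_def)
      moreover from this have "list_emb P (m (r (i - r 0))) (m (r (j - r 0)))"
        using e 3 ij by (auto simp: g_def mht)
      ultimately show False using m by (auto simp: bad_seq_def)
    qed
  qed
  \<comment> \<open>At index \<open>r 0\<close> the competitor has the shorter list
    \<open>t (r 0)\<close> after the same prefix, against the minimal choice of
    \<open>m (r 0)\<close>.\<close>
  moreover have "map g [0..<Suc (r 0)] = min_bad (r 0) @ [t (r 0)]"
    by (intro nth_equalityI)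
      (auto simp: g_def nth_append m_def min_bad_nth less_Suc_eq simp del: upt_Suc min_bad.simps)
  ultimately have "bad_prefix (min_bad (r 0) @ [t (r 0)])"
    unfolding bad_prefix_def by (intro exI[of _ g]) simp
  from min_bad_arg_min(2)[OF f this] have "length (m (r 0)) \<le> length (t (r 0))"
    by (simp add: m_def)
  then show False by (simp add: mht)
qed

end

text \<open>The embedding becomes a map of positions, continued beyond the end of \<open>xs\<close>
  to a strictly increasing function on all naturals, so that it can rename all the variables
  y_i.\<close>

lemma list_emb_index_map:
  assumes "list_emb P xs ys"
  shows "\<exists>\<pi>. strict_mono \<pi> \<and> (\<forall>i<length xs. \<pi> i < length ys \<and> P (xs ! i) (ys ! \<pi> i))"
  using assms
proof induction
  case (list_emb_Nil ys)
  show ?case by (intro exI[of _ id]) (auto simp: strict_mono_def)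
next
  case (list_emb_Cons xs ys y)
  then obtain \<pi> where "strict_mono \<pi>" "\<forall>i<length xs. \<pi> i < length ys \<and> P (xs ! i) (ys ! \<pi> i)"
    by blast
  then show ?case
    by (intro exI[of _ "\<lambda>i. Suc (\<pi> i)"]) (auto simp: strict_mono_def)
next
  case (list_emb_Cons2 x y xs ys)
  then obtain \<pi> where "strict_mono \<pi>" "\<forall>i<length xs. \<pi> i < length ys \<and> P (xs ! i) (ys ! \<pi> i)"
    by blast
  with list_emb_Cons2 show ?case
    by (intro exI[of _ "\<lambda>i. case i of 0 \<Rightarrow> 0 | Suc k \<Rightarrow> Suc (\<pi> k)"])
      (auto simp: strict_mono_def nth_Cons split: nat.splits)
qed

section \<open>Monomials up to increasing renaming\<close>

definition reindex :: "(nat \<Rightarrow> nat) \<Rightarrow> (nat \<times> 'v) multiset \<Rightarrow> (nat \<times> 'v) multiset" where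
  "reindex \<pi> = image_mset (map_prod \<pi> id)"

text \<open>Monomials in the variables indexed by \<^typ>\<open>nat\<close> times a finite set are read as words of
  exponent vectors, so that Higman's lemma applies.\<close>

theorem monomials_wqo:
  fixes \<alpha> :: "nat \<Rightarrow> (nat \<times> 'v) multiset"
  assumes V: "finite V" "\<And>k. snd ` set_mset (\<alpha> k) \<subseteq> V"
  shows "\<exists>i j \<pi>. i < j \<and> strict_mono \<pi> \<and> reindex \<pi> (\<alpha> i) \<subseteq># \<alpha> j"
proof -
  define P where "P f g \<longleftrightarrow> (\<forall>v\<in>V. f v \<le> g v)" for f g :: "'v \<Rightarrow> nat"
  have "\<exists>b. \<forall>x\<in>set_mset (\<alpha> k). fst x < b" for k
    using finite_nat_set_iff_bounded[of "fst ` set_mset (\<alpha> k)"] by auto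
  then obtain b where b: "\<And>k x. x \<in># \<alpha> k \<Longrightarrow> fst x < b k"
    by metis
  \<comment> \<open>Letter number \<open>i\<close> of \<open>W k\<close> is the exponent vector of
    the variables with first index \<open>i\<close>; \<open>b k\<close> exceeds all indices that
    occur, so nothing is lost.\<close>
  define W where "W k = map (\<lambda>i v. count (\<alpha> k) (i, v)) [0..<b k]" for k
  have "\<exists>i j. i < j \<and> list_emb P (W i) (W j)"
    by (rule higman) (use dickson_subseq[OF V(1)] in \<open>auto simp: P_def\<close>)
  then obtain i j where ij: "i < j" "list_emb P (W i) (W j)" by blast
  then obtain \<pi> where pi: "strict_mono \<pi>"
    "\<And>k. k < b i \<Longrightarrow> \<pi> k < b j \<and> P (W i ! k) (W j ! \<pi> k)"
    using list_emb_index_map[OF ij(2)] by (auto simp: W_def)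
  \<comment> \<open>Since the renaming is injective, a multiplicity in the image is a single
    multiplicity of \<open>\<alpha> i\<close>, not a sum of several.\<close>
  have inj: "inj (map_prod \<pi> (id :: 'v \<Rightarrow> 'v))"
    using strict_mono_imp_inj_on[OF pi(1)] by (simp add: prod.inj_map)
  have "count (reindex \<pi> (\<alpha> i)) x \<le> count (\<alpha> j) x" for x
  proof (cases "x \<in># reindex \<pi> (\<alpha> i)")
    case True
    then obtain k v where kv: "(k, v) \<in># \<alpha> i" "x = map_prod \<pi> id (k, v)"
      by (force simp: reindex_def)
    have "count (reindex \<pi> (\<alpha> i)) x = count (\<alpha> i) (k, v)"
    proof -
      have "{y. y \<in># \<alpha> i \<and> map_prod \<pi> id (k, v) = map_prod \<pi> id y} = {(k, v)}"
        using kv(1) injD[OF inj] by blast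
      then show ?thesis by (simp add: reindex_def kv(2) count_image_mset')
    qed
    moreover have "k < b i" "v \<in> V"
      using b[OF kv(1)] V(2)[of i] kv(1) by force+
    ultimately show ?thesis
      using pi(2)[of k] kv(2) by (auto simp: W_def P_def)
  qed (simp add: not_in_iff)
  then show ?thesis
    using ij(1) pi(1) by (auto simp: subseteq_mset_def)
qed

text \<open>Increasing renamings respect the lexicographic order of pairs, hence also its multiset
  extension, which serves as the monomial order.\<close>

lemma reindex_strict_mono:
  fixes \<alpha> \<beta> :: "(nat \<times> 'v::linorder) multiset"
  assumes "strict_mono \<pi>" "\<alpha> < \<beta>"
  shows "reindex \<pi> \<alpha> < reindex \<pi> \<beta>"
  unfolding reindex_def
  using assms by (intro image_mset_strict_mono) (auto simp: less_prod_def' strict_mono_def)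

section \<open>The free associative algebra\<close>

definition fa_scale :: "'f::field \<Rightarrow> 'f fa \<Rightarrow> 'f fa"  (infixr "*\<^sub>F" 75)
  where "c *\<^sub>F p = (\<lambda>w. c * p w)"

lemma fa_scale_apply [simp]: "(c *\<^sub>F p) w = c * p w"
  by (simp add: fa_scale_def)

interpretation fa: vector_space "fa_scale :: 'f::field \<Rightarrow> 'f fa \<Rightarrow> 'f fa"
  by unfold_locales (auto simp: fun_eq_iff algebra_simps)

definition supp :: "'f::field fa \<Rightarrow> var list set" where
  "supp p = {w. p w \<noteq> 0}"

definition mon :: "var list \<Rightarrow> 'f::field fa" where
  "mon w = (\<lambda>u. if u = w then 1 else 0)"

lemma mon_Nil: "mon [] = fa_one" and mon_single: "mon [v] = fa_var v"
  by (auto simp: mon_def fa_one_def fa_var_def)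

lemma supp_subset [simp]:
  "supp 0 = {}" "supp (mon w) = {w}" "supp (fa_var v) = {[v]}"
  "supp (p + q) \<subseteq> supp p \<union> supp q" "supp (c *\<^sub>F p) \<subseteq> supp p" "supp (p - q) \<subseteq> supp p \<union> supp q"
  by (auto simp: supp_def mon_def fa_var_def)

lemma finite_supp_add [simp]: "finite (supp p) \<Longrightarrow> finite (supp q) \<Longrightarrow> finite (supp (p + q))"
  and finite_supp_diff [simp]: "finite (supp p) \<Longrightarrow> finite (supp q) \<Longrightarrow> finite (supp (p - q))"
  and finite_supp_scale [simp]: "finite (supp p) \<Longrightarrow> finite (supp (c *\<^sub>F p))"
  using supp_subset(4-6) by (metis finite_Un finite_subset)+

lemma sum_fa_apply: "(\<Sum>i\<in>A. (f i :: 'f::field fa)) w = (\<Sum>i\<in>A. f i w)"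
  by (induction A rule: infinite_finite_induct) auto

lemma fa_expand:
  assumes "finite A" "supp p \<subseteq> A"
  shows "p = (\<Sum>w\<in>A. p w *\<^sub>F mon w)"
proof
  fix u
  have "(\<Sum>w\<in>A. p w *\<^sub>F mon w) u = (\<Sum>w\<in>A. if w = u then p w else 0)"
    by (auto simp: sum_fa_apply mon_def intro!: sum.cong)
  also have "\<dots> = p u"
    using assms by (auto simp: supp_def)
  finally show "p u = (\<Sum>w\<in>A. p w *\<^sub>F mon w) u" ..
qed

lemma fa_mult_Nil [simp]: "fa_mult p q [] = p [] * q []"
  by (simp add: fa_mult_def)

text \<open>Moving the first letter into the left factor turns identities of products into
  inductions on the word with an arbitrary left factor.\<close>

lemma fa_mult_Cons: "fa_mult p q (x # w) = p [] * q (x # w) + fa_mult (\<lambda>u. p (x # u)) q w"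
proof -
  have "{..Suc (length w)} = insert 0 (Suc ` {..length w})"
    by (simp add: atMost_Suc_eq_insert_0)
  then have "fa_mult p q (x # w) =
      p [] * q (x # w) + (\<Sum>k\<in>Suc ` {..length w}. p (take k (x # w)) * q (drop k (x # w)))"
    by (simp add: fa_mult_def)
  also have "(\<Sum>k\<in>Suc ` {..length w}. p (take k (x # w)) * q (drop k (x # w))) =
      fa_mult (\<lambda>u. p (x # u)) q w"
    by (simp add: fa_mult_def sum.reindex)
  finally show ?thesis .
qed

lemma fa_mult_add_left: "fa_mult (p + q) r = fa_mult p r + fa_mult q r"
  and fa_mult_add_right: "fa_mult r (p + q) = fa_mult r p + fa_mult r q"
  and fa_mult_diff_left: "fa_mult (p - q) r = fa_mult p r - fa_mult q r"
  and fa_mult_diff_right: "fa_mult r (p - q) = fa_mult r p - fa_mult r q"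
  and fa_mult_scale_left: "fa_mult (c *\<^sub>F p) r = c *\<^sub>F fa_mult p r"
  and fa_mult_scale_right: "fa_mult r (c *\<^sub>F p) = c *\<^sub>F fa_mult r p"
  by (auto simp: fa_mult_def fun_eq_iff algebra_simps sum.distrib sum_subtractf sum_distrib_left)

lemma fa_mult_zero_left [simp]: "fa_mult 0 q = 0"
  and fa_mult_zero_right [simp]: "fa_mult q 0 = 0"
  by (auto simp: fa_mult_def fun_eq_iff)

lemma fa_mult_assoc: "fa_mult (fa_mult p q) r = fa_mult p (fa_mult q r)"
proof
  show "fa_mult (fa_mult p q) r w = fa_mult p (fa_mult q r) w" for w
  proof (induction w arbitrary: p q)
    case (Cons x w)
    have "(\<lambda>u. fa_mult p q (x # u)) = p [] *\<^sub>F (\<lambda>u. q (x # u)) + fa_mult (\<lambda>u. p (x # u)) q"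
      by (auto simp: fa_mult_Cons)
    then show ?case
      by (simp add: fa_mult_Cons[of _ _ x w] fa_mult_add_left fa_mult_scale_left Cons.IH algebra_simps)
  qed simp
qed

lemma fa_mult_one_left [simp]: "fa_mult fa_one p = p"
proof
  show "fa_mult fa_one p w = p w" for w
  proof (cases w)
    case (Cons x u)
    have "(\<lambda>u. fa_one (x # u)) = (0 :: 'a fa)" by (auto simp: fa_one_def)
    then show ?thesis by (simp add: Cons fa_mult_Cons) (simp add: fa_one_def)
  qed (simp add: fa_one_def)
qed

lemma fa_mult_var_left:
  "fa_mult (fa_var v) p w = (case w of [] \<Rightarrow> 0 | x # u \<Rightarrow> if x = v then p u else 0)"
proof (cases w)
  case (Cons x u)
  have "(\<lambda>u. fa_var v (x # u)) = (if x = v then fa_one else (0 :: 'a fa))"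
    by (auto simp: fa_one_def fa_var_def)
  then show ?thesis by (simp add: Cons fa_mult_Cons) (simp add: fa_var_def)
qed (simp add: fa_var_def)

lemma fa_mult_var_mon: "fa_mult (fa_var v) (mon w) = mon (v # w)"
  by (auto simp: fun_eq_iff fa_mult_var_left mon_def split: list.splits)

lemma fa_mult_one_right [simp]: "fa_mult p fa_one = p"
proof
  show "fa_mult p fa_one w = p w" for w
    by (induction w arbitrary: p) (auto simp: fa_mult_Cons, auto simp: fa_one_def)
qed

lemma fa_mult_mon: "fa_mult (mon u) (mon v) = mon (u @ v)"
proof (induction u)
  case (Cons x u)
  then show ?case
    by (simp add: fa_mult_assoc flip: fa_mult_var_mon)
qed (simp add: mon_Nil)

lemma fa_mult_nonzeroE:
  assumes "fa_mult p q w \<noteq> 0"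
  obtains u v where "w = u @ v" "p u \<noteq> 0" "q v \<noteq> 0"
proof -
  obtain k where "k \<le> length w" "p (take k w) * q (drop k w) \<noteq> 0"
    using assms unfolding fa_mult_def by (metis (no_types, lifting) atMost_iff sum.not_neutral_contains_not_neutral)
  then show thesis using that[of "take k w" "drop k w"] by auto
qed

lemma finite_supp_mult [simp]:
  assumes "finite (supp p)" "finite (supp q)"
  shows "finite (supp (fa_mult p q))"
proof -
  have "supp (fa_mult p q) \<subseteq> (\<lambda>(u, v). u @ v) ` (supp p \<times> supp q)"
    by (auto simp: supp_def elim!: fa_mult_nonzeroE)
  then show ?thesis using assms by (meson finite_SigmaI finite_imageI finite_subset)
qed

lemma fa_bracket_eq: "fa_bracket p q = fa_mult p q - fa_mult q p"
  by (auto simp: fa_bracket_def)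

lemma finite_supp_bracket [simp]:
  "finite (supp p) \<Longrightarrow> finite (supp q) \<Longrightarrow> finite (supp (fa_bracket p q))"
  by (simp add: fa_bracket_eq)

lemma fa_bracket_add_left: "fa_bracket (p + q) r = fa_bracket p r + fa_bracket q r"
  and fa_bracket_add_right: "fa_bracket r (p + q) = fa_bracket r p + fa_bracket r q"
  and fa_bracket_diff_left: "fa_bracket (p - q) r = fa_bracket p r - fa_bracket q r"
  and fa_bracket_diff_right: "fa_bracket r (p - q) = fa_bracket r p - fa_bracket r q"
  and fa_bracket_scale_left: "fa_bracket (c *\<^sub>F p) r = c *\<^sub>F fa_bracket p r"
  and fa_bracket_scale_right: "fa_bracket r (c *\<^sub>F p) = c *\<^sub>F fa_bracket r p"
  by (auto simp: fa_bracket_eq fa_mult_add_left fa_mult_add_right fa_mult_scale_left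
      fa_mult_scale_right fa_mult_diff_left fa_mult_diff_right fa.scale_right_diff_distrib)

lemma fa_bracket_zero [simp]: "fa_bracket 0 q = 0" "fa_bracket q 0 = 0"
  by (auto simp: fa_bracket_eq)

lemma fa_bracket_anticomm: "fa_bracket p q = - fa_bracket q p"
  by (simp add: fa_bracket_eq fun_eq_iff)

text \<open>The letters stand for the six triple products in the expanded Jacobi identity; only
  additive cancellation is left.\<close>

lemma jacobi_cancel:
  fixes a b c d e f :: "'a::ab_group_add"
  shows "(a - b) - (c - d) = ((e - c) - (b - f)) + ((a - e) - (f - d))"
  by (simp add: algebra_simps)

text \<open>The Jacobi identity as the derivation rule for bracketing with \<open>r\<close> on the
  right, the form that rearranges left-normed brackets.\<close>

lemma fa_bracket_bracket_left:
  "fa_bracket (fa_bracket p q) r = fa_bracket (fa_bracket p r) q + fa_bracket p (fa_bracket q r)"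
  unfolding fa_bracket_eq fa_mult_diff_left fa_mult_diff_right fa_mult_assoc
  by (rule jacobi_cancel)

text \<open>Induction rules over functions produce eta-expanded sums, which these rules would break up.\<close>

declare plus_fun_apply [simp del] zero_fun_apply [simp del]
  minus_apply [simp del] uminus_apply [simp del] fa_scale_apply [simp del]

lemmas fa_apply = plus_fun_apply zero_fun_apply minus_apply uminus_apply fa_scale_apply

section \<open>Substitution homomorphisms\<close>

lemma fsubst_superset:
  assumes "finite A" "supp p \<subseteq> A"
  shows "fsubst \<sigma> p = (\<Sum>w\<in>A. p w *\<^sub>F word_prod \<sigma> w)"
proof
  fix u
  have "(\<Sum>w | p w \<noteq> 0. p w * word_prod \<sigma> w u) = (\<Sum>w\<in>A. p w * word_prod \<sigma> w u)"
    using assms by (intro sum.mono_neutral_left) (auto simp: supp_def)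
  then show "fsubst \<sigma> p u = (\<Sum>w\<in>A. p w *\<^sub>F word_prod \<sigma> w) u"
    by (simp add: fsubst_def sum_fa_apply fa_apply)
qed

lemma fsubst_mon [simp]: "fsubst \<sigma> (mon w) = word_prod \<sigma> w"
  by (subst fsubst_superset[of "{w}"]) (simp_all, simp add: mon_def)

lemma fsubst_var [simp]: "fsubst \<sigma> (fa_var v) = \<sigma> v"
  unfolding mon_single[symmetric] by (simp add: word_prod_def)

lemma fsubst_add:
  assumes "finite (supp p)" "finite (supp q)"
  shows "fsubst \<sigma> (p + q) = fsubst \<sigma> p + fsubst \<sigma> q"
proof -
  let ?A = "supp p \<union> supp q"
  have "fsubst \<sigma> (p + q) = (\<Sum>w\<in>?A. p w *\<^sub>F word_prod \<sigma> w) + (\<Sum>w\<in>?A. q w *\<^sub>F word_prod \<sigma> w)"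
    using assms supp_subset(4)[of p q]
    by (subst fsubst_superset[of ?A]) (auto simp: fa_apply fa.scale_left_distrib sum.distrib)
  also have "\<dots> = fsubst \<sigma> p + fsubst \<sigma> q"
    using assms by (simp add: fsubst_superset[of ?A])
  finally show ?thesis .
qed

lemma fsubst_scale:
  assumes "finite (supp p)"
  shows "fsubst \<sigma> (c *\<^sub>F p) = c *\<^sub>F fsubst \<sigma> p"
  using assms supp_subset(5)[of c p]
  by (simp add: fsubst_superset[of "supp p"] fa.scale_sum_right fa_apply)

lemma fsubst_zero [simp]: "fsubst \<sigma> 0 = 0"
  by (subst fsubst_superset[of "{}"]) auto

lemma fsubst_diff:
  assumes "finite (supp p)" "finite (supp q)"
  shows "fsubst \<sigma> (p - q) = fsubst \<sigma> p - fsubst \<sigma> q"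
proof -
  have "p - q = p + (-1) *\<^sub>F q" by simp
  then have "fsubst \<sigma> (p - q) = fsubst \<sigma> p + (-1) *\<^sub>F fsubst \<sigma> q"
    using assms by (simp only: fsubst_add fsubst_scale finite_supp_scale)
  then show ?thesis by simp
qed

lemma word_prod_append: "word_prod \<sigma> (u @ v) = fa_mult (word_prod \<sigma> u) (word_prod \<sigma> v)"
  by (induction u) (auto simp: word_prod_def fa_mult_assoc)

lemma fa_finite_induct [consumes 1, case_names zero add]:
  assumes "finite (supp p)" "P 0"
    and "\<And>c w q. finite (supp q) \<Longrightarrow> P q \<Longrightarrow> P (c *\<^sub>F mon w + q)"
  shows "P p"
proof -
  have "finite (supp (\<Sum>w\<in>A. p w *\<^sub>F mon w)) \<and> P (\<Sum>w\<in>A. p w *\<^sub>F mon w)" if "finite A" for A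
    using that assms(2,3) by (induction A rule: finite_induct) auto
  then have "P (\<Sum>w\<in>supp p. p w *\<^sub>F mon w)" using assms(1) by blast
  then show ?thesis
    by (simp only: fa_expand[OF assms(1) order_refl, symmetric])
qed

lemma fsubst_mult:
  assumes "finite (supp p)" "finite (supp q)"
  shows "fsubst \<sigma> (fa_mult p q) = fa_mult (fsubst \<sigma> p) (fsubst \<sigma> q)"
  using assms(1)
proof (induction p rule: fa_finite_induct)
  case (add c w p)
  have "fsubst \<sigma> (fa_mult (mon w) q) = fa_mult (word_prod \<sigma> w) (fsubst \<sigma> q)"
    using assms(2)
  proof (induction q rule: fa_finite_induct)
    case (add c w q)
    then show ?case
      by (simp add: fa_mult_add_right fa_mult_scale_right fsubst_add fsubst_scale fa_mult_mon word_prod_append)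
  qed simp
  with add assms(2) show ?case
    by (simp add: fa_mult_add_left fa_mult_scale_left fsubst_add fsubst_scale)
qed simp

lemma fsubst_bracket:
  assumes "finite (supp p)" "finite (supp q)"
  shows "fsubst \<sigma> (fa_bracket p q) = fa_bracket (fsubst \<sigma> p) (fsubst \<sigma> q)"
  using assms by (simp add: fa_bracket_eq fsubst_diff fsubst_mult)

section \<open>Elements and endomorphisms of the free Lie algebra\<close>

lemma freeLie_add: "p \<in> freeLie n \<Longrightarrow> q \<in> freeLie n \<Longrightarrow> p + q \<in> freeLie n"
  and freeLie_scale: "p \<in> freeLie n \<Longrightarrow> c *\<^sub>F p \<in> freeLie n"
  using freeLie.add[of p n q] freeLie.smult[of p n c] by (auto simp: plus_fun_def fa_scale_def)

lemma finite_supp_freeLie [simp]: "p \<in> freeLie n \<Longrightarrow> finite (supp p)"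
proof (induction rule: freeLie.induct)
  case (add p q)
  then show ?case using finite_supp_add[of p q] by (simp add: plus_fun_def)
next
  case (smult p c)
  then show ?case using finite_supp_scale[of p c] by (simp add: fa_scale_def)
qed auto

lemma freeLie_letters: "p \<in> freeLie n \<Longrightarrow> p w \<noteq> 0 \<Longrightarrow> v \<in> set w \<Longrightarrow> fst v < n"
proof (induction arbitrary: w rule: freeLie.induct)
  case (gen g i)
  then show ?case by (auto simp: fa_var_def split: if_splits)
next
  case (add p q)
  then have "p w \<noteq> 0 \<or> q w \<noteq> 0" by auto
  with add show ?case by blast
next
  case (smult p c)
  then show ?case by auto
next
  case (bracket p q)
  then have "fa_mult p q w \<noteq> 0 \<or> fa_mult q p w \<noteq> 0"
    by (auto simp: fa_bracket_eq fa_apply)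
  with bracket show ?case
    by (auto elim!: fa_mult_nonzeroE)
qed

lemma freeLie_induct [consumes 1, case_names var add scale bracket]:
  assumes "p \<in> freeLie n"
    and "\<And>g i. g < n \<Longrightarrow> P (fa_var (g, i))"
    and "\<And>p q. p \<in> freeLie n \<Longrightarrow> q \<in> freeLie n \<Longrightarrow> P p \<Longrightarrow> P q \<Longrightarrow> P (p + q)"
    and "\<And>c p. p \<in> freeLie n \<Longrightarrow> P p \<Longrightarrow> P (c *\<^sub>F p)"
    and "\<And>p q. p \<in> freeLie n \<Longrightarrow> q \<in> freeLie n \<Longrightarrow> P p \<Longrightarrow> P q \<Longrightarrow> P (fa_bracket p q)"
  shows "P p"
  using assms(1)
proof (induction rule: freeLie.induct)
  case (add p q)
  then show ?case using assms(3)[of p q] by (simp add: plus_fun_def)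
next
  case (smult p c)
  then show ?case using assms(4)[of p c] by (simp add: fa_scale_def)
qed (use assms in auto)

lemma fsubst_freeLie:
  assumes "p \<in> freeLie n" "graded_endo n \<sigma>"
  shows "fsubst \<sigma> p \<in> freeLie n"
  using assms(1)
proof (induction rule: freeLie_induct)
  case (var g i)
  then show ?case using assms(2) by (auto simp: graded_endo_def)
qed (auto simp: fsubst_add fsubst_scale fsubst_bracket intro: freeLie_add freeLie_scale freeLie.bracket)

lemma fsubst_fsubst:
  assumes "p \<in> freeLie n" "graded_endo n \<tau>"
  shows "fsubst \<sigma> (fsubst \<tau> p) = fsubst (\<lambda>v. fsubst \<sigma> (\<tau> v)) p"
  using assms(1)
  by (induction rule: freeLie_induct)
    (auto simp: fsubst_add fsubst_scale fsubst_bracket finite_supp_freeLie[OF fsubst_freeLie[OF _ assms(2)]])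

text \<open>Words are eigenvectors here. The cases of interest are the scaling of one variable and
  substitutions that fix every letter occurring in \<open>p\<close>.\<close>

lemma fsubst_diagonal:
  assumes "finite (supp p)" "\<And>w. p w \<noteq> 0 \<Longrightarrow> word_prod \<sigma> w = c w *\<^sub>F mon w"
  shows "fsubst \<sigma> p = (\<lambda>w. c w * p w)"
proof
  fix u
  have "fsubst \<sigma> p u = (\<Sum>w\<in>supp p. if u = w then c w * p w else 0)"
    unfolding fsubst_superset[OF assms(1) order_refl] sum_fa_apply
    by (intro sum.cong) (auto simp: assms(2) supp_def mon_def fa_apply)
  also have "\<dots> = c u * p u" using assms(1) by (auto simp: supp_def)
  finally show "fsubst \<sigma> p u = c u * p u" .
qed

lemma word_prod_Cons: "word_prod \<sigma> (v # w) = fa_mult (\<sigma> v) (word_prod \<sigma> w)"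
  and word_prod_Nil: "word_prod \<sigma> [] = mon []"
  by (auto simp: word_prod_def mon_Nil)

lemma word_prod_scaled_vars:
  assumes "\<And>v. v \<in> set w \<Longrightarrow> \<sigma> v = c v *\<^sub>F fa_var v"
  shows "word_prod \<sigma> w = (\<Prod>v\<leftarrow>w. c v) *\<^sub>F mon w"
  using assms
  by (induction w)
    (auto simp: word_prod_Cons word_prod_Nil fa_mult_scale_left fa_mult_scale_right fa_mult_var_mon mult_ac)

lemma fsubst_id:
  assumes "finite (supp p)" "\<And>w v. p w \<noteq> 0 \<Longrightarrow> v \<in> set w \<Longrightarrow> \<sigma> v = fa_var v"
  shows "fsubst \<sigma> p = p"
proof -
  have "word_prod \<sigma> w = 1 *\<^sub>F mon w" if "p w \<noteq> 0" for w
  proof -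
    have "word_prod \<sigma> w = (\<Prod>v\<leftarrow>w. 1) *\<^sub>F mon w"
      using assms(2)[OF that] by (intro word_prod_scaled_vars) auto
    then show ?thesis by (simp add: map_replicate_const)
  qed
  then show ?thesis
    using fsubst_diagonal[OF assms(1), of \<sigma> "\<lambda>_. 1"] by simp
qed

lemma word_prod_rename: "word_prod (\<lambda>v. fa_var (\<rho> v)) w = mon (map \<rho> w)"
  by (induction w) (auto simp: word_prod_Cons word_prod_Nil fa_mult_var_mon)

section \<open>Degree functions on words\<close>

definition degree_on :: "(var list \<Rightarrow> 'd) \<Rightarrow> 'd \<Rightarrow> 'f::field fa \<Rightarrow> bool" where
  "degree_on D a p \<longleftrightarrow> (\<forall>w. p w \<noteq> 0 \<longrightarrow> D w = a)"

text \<open>Both orders of multiplication occur in a bracket, hence the symmetry assumption on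
  \<open>f\<close>. The instances are the Z_n-degree and the multidegree in the z's.\<close>

lemma degree_on_bracket:
  assumes "degree_on D a p" "degree_on D b q"
    and "\<And>u v. D (u @ v) = f (D u) (D v)" "f a b = f b a"
  shows "degree_on D (f a b) (fa_bracket p q)"
  unfolding degree_on_def
proof (intro allI impI)
  fix w assume "fa_bracket p q w \<noteq> 0"
  then have "fa_mult p q w \<noteq> 0 \<or> fa_mult q p w \<noteq> 0" by (auto simp: fa_bracket_eq fa_apply)
  then show "D w = f a b"
    using assms by (auto simp: degree_on_def elim!: fa_mult_nonzeroE)
qed

lemma homog_bracket:
  assumes "homog n g p" "homog n h q"
  shows "homog n ((g + h) mod n) (fa_bracket p q)"
proof -
  have "degree_on (wdeg n) ((g + h) mod n) (fa_bracket p q)"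
    using assms by (intro degree_on_bracket[where f = "\<lambda>a b. (a + b) mod n"])
      (auto simp: degree_on_def homog_def wdeg_def mod_add_eq add.commute)
  then show ?thesis by (simp add: degree_on_def homog_def)
qed

lemma homog_var: "g < n \<Longrightarrow> homog n g (fa_var (g, i))"
  by (auto simp: homog_def fa_var_def wdeg_def)

text \<open>Degrees in the y's are forgotten on purpose: the y's act as polynomial coefficients and
  their number is unbounded.\<close>

definition zdeg :: "var list \<Rightarrow> var \<Rightarrow> nat" where
  "zdeg w = (\<lambda>v. if fst v = 0 then 0 else count_list w v)"

lemma zdeg_append: "zdeg (u @ v) = zdeg u + zdeg v"
  by (auto simp: zdeg_def fun_eq_iff fa_apply)

lemma zdeg_bracket:
  "degree_on zdeg a p \<Longrightarrow> degree_on zdeg b q \<Longrightarrow> degree_on zdeg (a + b) (fa_bracket p q)"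
  by (rule degree_on_bracket[where f = "(+)"]) (auto simp: zdeg_append add.commute)

section \<open>T-ideals and homogeneous components\<close>

lemma T_ideal_subset: "T_ideal n J \<Longrightarrow> J \<subseteq> freeLie n"
  and T_ideal_zero: "T_ideal n J \<Longrightarrow> 0 \<in> J"
  and T_ideal_add: "T_ideal n J \<Longrightarrow> p \<in> J \<Longrightarrow> q \<in> J \<Longrightarrow> p + q \<in> J"
  and T_ideal_scale: "T_ideal n J \<Longrightarrow> p \<in> J \<Longrightarrow> c *\<^sub>F p \<in> J"
  and T_ideal_bracket: "T_ideal n J \<Longrightarrow> p \<in> J \<Longrightarrow> r \<in> freeLie n \<Longrightarrow> fa_bracket p r \<in> J"
  and T_ideal_subst: "T_ideal n J \<Longrightarrow> p \<in> J \<Longrightarrow> graded_endo n \<sigma> \<Longrightarrow> fsubst \<sigma> p \<in> J"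
  by (auto simp: T_ideal_def plus_fun_def zero_fun_def fa_scale_def)

lemma T_ideal_subspace: "T_ideal n J \<Longrightarrow> fa.subspace J"
  by (auto simp: fa.subspace_def T_ideal_zero T_ideal_add T_ideal_scale)

lemmas T_ideal_diff = fa.subspace_diff[OF T_ideal_subspace]
lemmas T_ideal_neg = fa.subspace_neg[OF T_ideal_subspace]
lemmas T_ideal_sum = fa.subspace_sum[OF T_ideal_subspace]

lemma T_ideal_bracket_right:
  "T_ideal n J \<Longrightarrow> p \<in> J \<Longrightarrow> r \<in> freeLie n \<Longrightarrow> fa_bracket r p \<in> J"
  by (metis T_ideal_bracket T_ideal_neg fa_bracket_anticomm)

lemma T_gen_least: "T_ideal n J \<Longrightarrow> S \<subseteq> J \<Longrightarrow> T_gen n S \<subseteq> J"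
  and T_gen_superset: "S \<subseteq> T_gen n S"
  by (auto simp: T_gen_def)

text \<open>The T-ideal \<open>J\<close> ensures that the intersection runs over a nonempty family
  and so stays inside the free Lie algebra.\<close>

lemma T_ideal_T_gen:
  assumes "T_ideal n J" "S \<subseteq> J"
  shows "T_ideal n (T_gen n S)"
proof -
  have sub: "T_gen n S \<subseteq> freeLie n"
    using T_gen_least[OF assms] T_ideal_subset[OF assms(1)] by blast
  have lift: "f \<in> T_gen n S" if "\<And>K. T_ideal n K \<Longrightarrow> T_gen n S \<subseteq> K \<Longrightarrow> f \<in> K" for f
    using that T_gen_least by (auto simp: T_gen_def)
  show ?thesis
    unfolding T_ideal_def[of n "T_gen n S"]
    by (intro conjI sub ballI allI impI; rule lift; simp add: T_ideal_def subset_iff)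
qed

lemma graded_endoI:
  assumes "\<And>g i. g < n \<Longrightarrow> \<sigma> (g, i) \<in> freeLie n" "\<And>g i. g < n \<Longrightarrow> homog n g (\<sigma> (g, i))"
  shows "graded_endo n \<sigma>"
  using assms by (auto simp: graded_endo_def)

lemma freeLie_var: "fst v < n \<Longrightarrow> fa_var v \<in> freeLie n"
  by (cases v) (simp add: freeLie.gen)

lemma homog_var_fst: "fst v < n \<Longrightarrow> homog n (fst v) (fa_var v)"
  by (cases v) (simp add: homog_var)

lemma homog_add: "homog n g p \<Longrightarrow> homog n g q \<Longrightarrow> homog n g (p + q)"
  and homog_scale: "homog n g p \<Longrightarrow> homog n g (c *\<^sub>F p)"
  by (auto simp: homog_def fa_apply) (metis add_0)

text \<open>Only 0 and the roots of X^k - 1 with 1 \<le> k \<le> N must be avoided, and these are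
  finitely many.\<close>

lemma ex_powers_distinct:
  assumes "infinite (UNIV :: 'f::field set)"
  shows "\<exists>a :: 'f. \<forall>d\<le>N. \<forall>e\<le>N. a ^ d = a ^ e \<longrightarrow> d = e"
proof -
  have fin: "finite {a :: 'f. a ^ k = 1}" if "k > 0" for k
  proof -
    have "monom 1 k - 1 \<noteq> (0 :: 'f poly)"
    proof
      assume "monom 1 k - 1 = (0 :: 'f poly)"
      then have "coeff (monom 1 k - 1 :: 'f poly) k = 0" by simp
      then show False using that by simp
    qed
    from poly_roots_finite[OF this] show ?thesis
      by (simp add: poly_monom)
  qed
  have "finite ({0} \<union> (\<Union>k\<in>{1..N}. {a :: 'f. a ^ k = 1}))"
    using fin by auto
  then obtain a :: 'f where "a \<notin> {0} \<union> (\<Union>k\<in>{1..N}. {a. a ^ k = 1})"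
    using assms by (metis ex_new_if_finite)
  then have a: "a \<noteq> 0" "\<And>k. k > 0 \<Longrightarrow> k \<le> N \<Longrightarrow> a ^ k \<noteq> 1" by auto
  have *: False if "d < e" "e \<le> N" "a ^ d = a ^ e" for d e
  proof -
    have "a ^ e = a ^ d * a ^ (e - d)"
      using that(1) by (simp flip: power_add)
    then have "a ^ (e - d) = 1" using that(3) a(1) by simp
    then show False using a(2)[of "e - d"] that by simp
  qed
  show ?thesis
  proof (intro exI[of _ a] allI impI)
    fix d e assume "d \<le> N" "e \<le> N" "a ^ d = a ^ e"
    then show "d = e" using *[of d e] *[of e d] by (cases d e rule: linorder_cases) auto
  qed
qed

definition count_part :: "var \<Rightarrow> nat \<Rightarrow> 'f::field fa \<Rightarrow> 'f fa" where
  "count_part v d p = (\<lambda>w. if count_list w v = d then p w else 0)"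

lemma fsubst_scale_var:
  assumes "finite (supp p)"
  shows "fsubst (\<lambda>u. if u = v then a *\<^sub>F fa_var u else fa_var u) p = (\<lambda>w. a ^ count_list w v * p w)"
proof (rule fsubst_diagonal[OF assms])
  fix w
  have "word_prod (\<lambda>u. if u = v then a *\<^sub>F fa_var u else fa_var u) w =
      (\<Prod>u\<leftarrow>w. if u = v then a else 1) *\<^sub>F mon w"
    by (rule word_prod_scaled_vars) auto
  also have "(\<Prod>u\<leftarrow>w. if u = v then a else 1) = a ^ count_list w v"
    by (induction w) auto
  finally show "word_prod (\<lambda>u. if u = v then a *\<^sub>F fa_var u else fa_var u) w =
      a ^ count_list w v *\<^sub>F mon w" .
qed

text \<open>With distinct powers of the scalar a, the scaling of v acts on the homogeneous parts with
  distinct eigenvalues, so a product of shifted scalings isolates one of them.\<close>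

lemma T_ideal_count_part:
  fixes J :: "'f::field fa set"
  assumes inf: "infinite (UNIV :: 'f set)" and J: "T_ideal n J" and p: "p \<in> J"
  shows "count_part v d p \<in> J"
proof -
  have fs: "finite (supp q)" if "q \<in> J" for q
    using T_ideal_subset[OF J] that by auto
  define N where "N = Max (insert d ((\<lambda>w. count_list w v) ` supp p))"
  have N: "d \<le> N" "\<And>w. p w \<noteq> 0 \<Longrightarrow> count_list w v \<le> N"
    using fs[OF p] by (auto simp: N_def supp_def)
  obtain a :: 'f where a: "\<And>d e. d \<le> N \<Longrightarrow> e \<le> N \<Longrightarrow> a ^ d = a ^ e \<Longrightarrow> d = e"
    using ex_powers_distinct[OF inf, of N] by blast
  let ?\<sigma> = "\<lambda>u. if u = v then a *\<^sub>F fa_var u else fa_var u"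
  have \<sigma>: "graded_endo n ?\<sigma>"
    by (rule graded_endoI) (auto intro: freeLie_scale freeLie.gen homog_scale homog_var)
  have E: "(\<lambda>w. (\<Prod>e\<in>E. a ^ count_list w v - a ^ e) * p w) \<in> J" if "finite E" for E
    using that
  proof (induction E rule: finite_induct)
    case empty
    then show ?case using p by simp
  next
    case (insert e E)
    let ?q = "\<lambda>w. (\<Prod>e\<in>E. a ^ count_list w v - a ^ e) * p w"
    have "fsubst ?\<sigma> ?q - a ^ e *\<^sub>F ?q \<in> J"
      using insert.IH by (intro T_ideal_diff[OF J] T_ideal_scale[OF J] T_ideal_subst[OF J] \<sigma>)
    also have "fsubst ?\<sigma> ?q - a ^ e *\<^sub>F ?q = (\<lambda>w. (\<Prod>e\<in>insert e E. a ^ count_list w v - a ^ e) * p w)"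
      unfolding fsubst_scale_var[OF fs[OF insert.IH]]
      using insert.hyps by (simp add: fun_eq_iff fa_apply algebra_simps)
    finally show ?case .
  qed
  \<comment> \<open>With all competing exponents in \<open>?E\<close>, the product annihilates the
    words of other degrees in \<open>v\<close> and multiplies those of degree \<open>d\<close> by
    the nonzero scalar \<open>?c\<close>.\<close>
  let ?E = "{..N} - {d}"
  let ?c = "\<Prod>e\<in>?E. a ^ d - a ^ e"
  have c: "?c \<noteq> 0" using a N(1) by (force simp: prod_zero_iff)
  have "inverse ?c *\<^sub>F (\<lambda>w. (\<Prod>e\<in>?E. a ^ count_list w v - a ^ e) * p w) \<in> J"
    by (intro T_ideal_scale[OF J] E) simp
  also have "inverse ?c *\<^sub>F (\<lambda>w. (\<Prod>e\<in>?E. a ^ count_list w v - a ^ e) * p w) = count_part v d p"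
  proof
    fix w
    have "(\<Prod>e\<in>?E. a ^ count_list w v - a ^ e) = 0" if "p w \<noteq> 0" "count_list w v \<noteq> d"
      using N(2)[OF that(1)] that(2) by (intro prod_zero) auto
    then show "(inverse ?c *\<^sub>F (\<lambda>w. (\<Prod>e\<in>?E. a ^ count_list w v - a ^ e) * p w)) w = count_part v d p w"
      using c by (auto simp: fa_apply count_part_def)
  qed
  finally show ?thesis .
qed

definition zdeg_part :: "(var \<Rightarrow> nat) \<Rightarrow> 'f::field fa \<Rightarrow> 'f fa" where
  "zdeg_part m p = (\<lambda>w. if zdeg w = m then p w else 0)"

lemma degree_on_zdeg_part: "degree_on zdeg m (zdeg_part m p)"
  by (auto simp: degree_on_def zdeg_part_def)

lemma zdeg_part_add: "zdeg_part m (p + q) = zdeg_part m p + zdeg_part m q"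
  and zdeg_part_scale: "zdeg_part m (c *\<^sub>F p) = c *\<^sub>F zdeg_part m p"
  and zdeg_part_zero: "zdeg_part m 0 = 0"
  by (auto simp: zdeg_part_def fun_eq_iff fa_apply)

lemma zdeg_part_degree_on: "degree_on zdeg m' p \<Longrightarrow> zdeg_part m p = (if m' = m then p else 0)"
  by (auto simp: zdeg_part_def degree_on_def fun_eq_iff fa_apply)

text \<open>Only the finitely many z's occurring in \<open>p\<close> matter; the component is cut
  out by applying \<open>count_part\<close> for each of them in turn.\<close>

lemma T_ideal_zdeg_part:
  fixes J :: "'f::field fa set"
  assumes inf: "infinite (UNIV :: 'f set)" and J: "T_ideal n J" and p: "p \<in> J"
  shows "zdeg_part m p \<in> J"
proof (cases "\<exists>w\<in>supp p. zdeg w = m")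
  case False
  then have "zdeg_part m p = 0"
    by (auto simp: zdeg_part_def supp_def fun_eq_iff fa_apply)
  then show ?thesis using T_ideal_zero[OF J] by simp
next
  case True
  define W where "W = {v \<in> \<Union>(set ` supp p). fst v \<noteq> 0}"
  have fin: "finite W"
    using T_ideal_subset[OF J] p by (auto simp: W_def)
  have *: "(\<lambda>w. if \<forall>v\<in>U. count_list w v = m v then p w else 0) \<in> J" if "finite U" for U
    using that
  proof (induction U rule: finite_induct)
    case empty
    then show ?case using p by simp
  next
    case (insert v U)
    have "count_part v (m v) (\<lambda>w. if \<forall>v\<in>U. count_list w v = m v then p w else 0) \<in> J"
      using T_ideal_count_part[OF inf J insert.IH] .
    also have "count_part v (m v) (\<lambda>w. if \<forall>v\<in>U. count_list w v = m v then p w else 0) =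
       (\<lambda>w. if \<forall>v\<in>insert v U. count_list w v = m v then p w else 0)"
      by (auto simp: count_part_def)
    finally show ?case .
  qed
  \<comment> \<open>The word \<open>w0\<close> shows that \<open>m\<close> vanishes at the y's and
    at the z's outside \<open>W\<close>, where counts are not tested.\<close>
  obtain w0 where w0: "p w0 \<noteq> 0" "zdeg w0 = m" using True by (auto simp: supp_def)
  have out: "count_list w v = 0" if "p w \<noteq> 0" "v \<notin> W" "fst v \<noteq> 0" for w v
    using that by (auto simp: W_def supp_def count_list_0_iff)
  have "(\<forall>v\<in>W. count_list w v = m v) \<longleftrightarrow> zdeg w = m" if "p w \<noteq> 0" for w
  proof
    assume A: "\<forall>v\<in>W. count_list w v = m v"
    show "zdeg w = m"
    proof
      fix v
      consider "fst v = 0" | "v \<in> W" | "fst v \<noteq> 0" "v \<notin> W" by blast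
      then show "zdeg w v = m v"
      proof cases
        case 1
        then show ?thesis using w0(2) by (auto simp: zdeg_def)
      next
        case 2
        moreover from 2 have "fst v \<noteq> 0" by (simp add: W_def)
        ultimately show ?thesis using A by (simp add: zdeg_def)
      next
        case 3
        then have "zdeg w v = 0" "zdeg w0 v = 0"
          using out[OF that] out[OF w0(1)] by (auto simp: zdeg_def)
        then show ?thesis using w0(2) by simp
      qed
    qed
  qed (auto simp: W_def zdeg_def)
  then have "zdeg_part m p = (\<lambda>w. if \<forall>v\<in>W. count_list w v = m v then p w else 0)"
    by (auto simp: zdeg_part_def fun_eq_iff)
  with *[OF fin] show ?thesis by simp
qed

lemma zdeg_part_decompose:
  assumes "finite (supp p)"
  shows "p = (\<Sum>m\<in>zdeg ` supp p. zdeg_part m p)"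
proof
  fix w
  have "(\<Sum>m\<in>zdeg ` supp p. zdeg_part m p) w = (\<Sum>m\<in>zdeg ` supp p. if zdeg w = m then p w else 0)"
    by (simp add: sum_fa_apply zdeg_part_def)
  also have "\<dots> = p w"
    using assms by (auto simp: supp_def)
  finally show "p w = (\<Sum>m\<in>zdeg ` supp p. zdeg_part m p) w" ..
qed

section \<open>Partial linearization\<close>

definition merge_var :: "var \<Rightarrow> var \<Rightarrow> var \<Rightarrow> var" where
  "merge_var z t x = (if x = t then z else x)"

text \<open>Expanding the product chooses \<open>z\<close> or \<open>t\<close> at each occurrence of
  \<open>z\<close>; as \<open>t\<close> does not occur in \<open>w\<close>, this produces exactly
  the words that merge to \<open>w\<close>, each once.\<close>

lemma word_prod_split_var:
  assumes "t \<notin> set w"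
  shows "word_prod (\<lambda>u. if u = z then fa_var z + fa_var t else fa_var u) w =
    (\<lambda>u. if map (merge_var z t) u = w then 1 else 0)"
  using assms
proof (induction w)
  case Nil
  then show ?case by (auto simp: word_prod_Nil mon_def)
next
  case (Cons x w)
  then show ?case
    by (cases "z = t") (auto simp: word_prod_Cons fun_eq_iff fa_mult_add_left fa_apply fa_mult_var_left merge_var_def
        split: list.splits)
qed

lemma fsubst_split_var:
  assumes "finite (supp p)" "\<And>w. p w \<noteq> 0 \<Longrightarrow> t \<notin> set w"
  shows "fsubst (\<lambda>u. if u = z then fa_var z + fa_var t else fa_var u) p = (\<lambda>u. p (map (merge_var z t) u))"
proof
  fix u
  let ?\<sigma> = "\<lambda>u. if u = z then fa_var z + fa_var t else fa_var u :: 'a fa"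
  have "fsubst ?\<sigma> p u = (\<Sum>w\<in>supp p. if map (merge_var z t) u = w then p w else 0)"
    unfolding fsubst_superset[OF assms(1) order_refl] sum_fa_apply fa_scale_apply
    by (intro sum.cong refl, subst word_prod_split_var) (use assms(2) in \<open>auto simp: supp_def\<close>)
  also have "\<dots> = p (map (merge_var z t) u)"
    using assms(1) by (auto simp: supp_def)
  finally show "fsubst ?\<sigma> p u = p (map (merge_var z t) u)" .
qed

lemma count_list_merge_var:
  assumes "z \<noteq> t"
  shows "count_list (map (merge_var z t) u) x =
    (if x = t then 0 else if x = z then count_list u z + count_list u t else count_list u x)"
  using assms by (induction u) (auto simp: merge_var_def)

lemma merge_var_preimage_0:
  assumes "t \<notin> set w" "z \<noteq> t"
  shows "{u. map (merge_var z t) u = w \<and> count_list u t = 0} = {w}"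
  using assms
proof (induction w)
  case (Cons x w)
  have "{u. map (merge_var z t) u = x # w \<and> count_list u t = 0} =
     (#) x ` {u. map (merge_var z t) u = w \<and> count_list u t = 0}"
    using Cons.prems by (auto simp: map_eq_Cons_conv merge_var_def simp del: split_paired_Ex split: if_splits)
  then show ?case using Cons by simp
qed auto

text \<open>Such a word is determined by the occurrence of \<open>z\<close> that was turned into
  \<open>t\<close>.\<close>

lemma merge_var_preimage_1:
  assumes "t \<notin> set w" "z \<noteq> t"
  shows "finite {u. map (merge_var z t) u = w \<and> count_list u t = 1} \<and>
    card {u. map (merge_var z t) u = w \<and> count_list u t = 1} = count_list w z"
  using assms
proof (induction w)
  case Nil
  then show ?case by auto
next
  case (Cons x w)
  let ?C = "\<lambda>w k. {u. map (merge_var z t) u = w \<and> count_list u t = k}"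
  have IH: "finite (?C w 1)" "card (?C w 1) = count_list w z" using Cons by auto
  have eq: "?C (x # w) 1 = (#) x ` ?C w 1 \<union> (if x = z then (#) t ` ?C w 0 else {})"
    using Cons.prems by (auto simp: map_eq_Cons_conv merge_var_def simp del: split_paired_Ex split: if_splits)
  show ?case
  proof (cases "x = z")
    case True
    have "?C (x # w) 1 = (#) z ` ?C w 1 \<union> {t # w}"
      using eq True merge_var_preimage_0[of t w z] Cons.prems by simp
    moreover have "card ((#) z ` ?C w 1 \<union> {t # w}) = card ((#) z ` ?C w 1) + 1"
      using IH(1) Cons.prems by (subst card_Un_disjoint) auto
    moreover have "card ((#) z ` ?C w 1) = count_list w z"
      using IH(2) by (simp add: card_image)
    ultimately show ?thesis using True IH(1) by simp
  next
    case False
    then have "?C (x # w) 1 = (#) x ` ?C w 1" using eq by simp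
    then show ?thesis using False IH by (simp add: card_image)
  qed
qed

text \<open>Each word of \<open>p\<close> comes from \<open>d\<close> words of \<open>q\<close>, one
  for each occurrence of \<open>z\<close>, so merging the variables again costs the factor
  \<open>d\<close>.\<close>

lemma linearize_restore:
  fixes p :: "'f::field fa"
  assumes "finite (supp p)" "\<And>w. p w \<noteq> 0 \<Longrightarrow> t \<notin> set w" "\<And>w. p w \<noteq> 0 \<Longrightarrow> count_list w z = d"
    and "z \<noteq> t"
    and q: "q = count_part t 1 (\<lambda>u. p (map (merge_var z t) u))" "finite (supp q)"
  shows "fsubst (\<lambda>x. fa_var (merge_var z t x)) q = of_nat d *\<^sub>F p"
proof
  fix x
  have "fsubst (\<lambda>x. fa_var (merge_var z t x)) q x =
      (\<Sum>u\<in>supp q. if map (merge_var z t) u = x then p x else 0)"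
    unfolding fsubst_superset[OF q(2) order_refl] sum_fa_apply fa_apply word_prod_rename
    by (intro sum.cong) (auto simp: mon_def q(1) count_part_def supp_def)
  also have "\<dots> = of_nat (card {u \<in> supp q. map (merge_var z t) u = x}) * p x"
    using q(2) by (simp add: sum.If_cases Int_def)
  also have "\<dots> = of_nat d * p x"
  proof (cases "p x = 0")
    case False
    then have "{u \<in> supp q. map (merge_var z t) u = x} =
        {u. map (merge_var z t) u = x \<and> count_list u t = 1}"
      by (auto simp: supp_def q(1) count_part_def)
    then show ?thesis
      using merge_var_preimage_1[of t x z] assms(2-4) False by simp
  qed simp
  finally show "fsubst (\<lambda>x. fa_var (merge_var z t x)) q x = (of_nat d *\<^sub>F p) x"
    by (simp add: fa_apply)
qed

lemma graded_endo_rename: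
  assumes "\<And>v. fst v < n \<Longrightarrow> fst (\<rho> v) = fst v"
  shows "graded_endo n (\<lambda>v. fa_var (\<rho> v))"
proof (rule graded_endoI)
  fix g i assume "g < n"
  with assms[of "(g, i)"] show "fa_var (\<rho> (g, i)) \<in> freeLie n" "homog n g (fa_var (\<rho> (g, i)))"
    using freeLie_var[of "\<rho> (g, i)" n] homog_var_fst[of "\<rho> (g, i)" n] by auto
qed

text \<open>Partial linearization of one variable, which can be undone since its degree is invertible.\<close>

lemma T_ideal_linearize:
  fixes J :: "'f::field fa set"
  assumes inf: "infinite (UNIV :: 'f set)" and J: "T_ideal n J" and p: "p \<in> J"
    and m: "degree_on zdeg m p" and z: "fst z \<noteq> 0" and t: "fst t = fst z" "m t = 0" "z \<noteq> t"
    and d: "(of_nat (m z) :: 'f) \<noteq> 0"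
  obtains q where "q \<in> J" "degree_on zdeg (m(z := m z - 1, t := 1)) q"
    "\<And>K. T_ideal n K \<Longrightarrow> q \<in> K \<Longrightarrow> p \<in> K"
proof -
  let ?\<sigma> = "\<lambda>u. if u = z then fa_var z + fa_var t else fa_var u :: 'f fa"
  have fin: "finite (supp p)" using T_ideal_subset[OF J] p by auto
  have cnt: "count_list w v = m v" if "p w \<noteq> 0" "fst v \<noteq> 0" for w v
  proof -
    have "zdeg w v = m v" using m that(1) by (simp add: degree_on_def)
    then show ?thesis using that(2) by (simp add: zdeg_def)
  qed
  have tw: "t \<notin> set w" if "p w \<noteq> 0" for w
    using cnt[OF that, of t] t z by (auto simp: count_list_0_iff)
  have zw: "count_list w z = m z" if "p w \<noteq> 0" for w
    using cnt[OF that z] .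
  have "graded_endo n ?\<sigma>"
  proof (rule graded_endoI)
    fix g i assume "g < n"
    then show "?\<sigma> (g, i) \<in> freeLie n" "homog n g (?\<sigma> (g, i))"
      using t freeLie_var[of t n] homog_var_fst[of t n]
      by (auto intro!: freeLie_add homog_add freeLie.gen homog_var)
  qed
  \<comment> \<open>Substituting z + t for z and taking the part linear in \<open>t\<close> is the
    partial linearization; both steps stay in \<open>J\<close>.\<close>
  then have "count_part t 1 (fsubst ?\<sigma> p) \<in> J"
    by (intro T_ideal_count_part[OF inf J] T_ideal_subst[OF J p])
  moreover define q where "q = count_part t 1 (\<lambda>u. p (map (merge_var z t) u))"
  ultimately have qJ: "q \<in> J" by (simp add: fsubst_split_var[OF fin tw])
  have "fsubst (\<lambda>x. fa_var (merge_var z t x)) q = of_nat (m z) *\<^sub>F p"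
    using T_ideal_subset[OF J] qJ by (intro linearize_restore[OF fin tw zw t(3) q_def]) auto
  then have pe: "p = inverse (of_nat (m z)) *\<^sub>F fsubst (\<lambda>x. fa_var (merge_var z t x)) q"
    using d by simp
  have "graded_endo n (\<lambda>x. fa_var (merge_var z t x) :: 'f fa)"
    using t by (intro graded_endo_rename) (auto simp: merge_var_def)
  then have "p \<in> K" if "T_ideal n K" "q \<in> K" for K
    unfolding pe using that by (intro T_ideal_scale T_ideal_subst)
  moreover have "degree_on zdeg (m(z := m z - 1, t := 1)) q"
    unfolding degree_on_def
  proof (intro allI impI)
    fix u assume "q u \<noteq> 0"
    then have u: "p (map (merge_var z t) u) \<noteq> 0" "count_list u t = 1"
      by (auto simp: q_def count_part_def split: if_splits)
    have "zdeg u v = (m(z := m z - 1, t := 1)) v" for v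
    proof (cases "fst v = 0")
      case True
      moreover have "m v = 0" using m u(1) True by (auto simp: degree_on_def zdeg_def)
      ultimately show ?thesis using z t by (auto simp: zdeg_def)
    next
      case False
      from cnt[OF u(1) this] count_list_merge_var[OF t(3), of u v] show ?thesis
        using False u(2) t(3) by (auto simp: zdeg_def split: if_splits)
    qed
    then show "zdeg u = m(z := m z - 1, t := 1)" by auto
  qed
  ultimately show thesis using that[of q] qJ by simp
qed

section \<open>Spanning sets modulo the basic identities\<close>

definition y_var :: "nat \<Rightarrow> 'f::field fa" where
  "y_var i = fa_var (0, i)"

definition ad_ys :: "'f::field fa \<Rightarrow> nat list \<Rightarrow> 'f fa" where
  "ad_ys p is = foldl (\<lambda>q i. fa_bracket q (y_var i)) p is"

definition left_normed :: "'f::field fa list \<Rightarrow> 'f fa" where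
  "left_normed ps = foldl fa_bracket (hd ps) (tl ps)"

text \<open>A list of pairs \<open>(z, [i\<^sub>1, \<dots>, i\<^sub>r])\<close> stands for the left-normed bracket of the elements
  \<open>[z, y\<^bsub>i\<^sub>1\<^esub>, \<dots>, y\<^bsub>i\<^sub>r\<^esub>]\<close>.\<close>

definition zy_bracket :: "(var \<times> nat list) list \<Rightarrow> 'f::field fa" where
  "zy_bracket t = left_normed (map (\<lambda>(v, is). ad_ys (fa_var v) is) t)"

text \<open>The empty list is excluded because \<open>left_normed\<close> has no meaningful value
  there.\<close>

definition zy_terms :: "nat \<Rightarrow> (var \<times> nat list) list set" where
  "zy_terms n = {t. t \<noteq> [] \<and> (\<forall>v\<in>fst ` set t. 0 < fst v \<and> fst v < n)}"

lemma ad_ys_simps [simp]: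
  "ad_ys p [] = p" "ad_ys p (i # is) = ad_ys (fa_bracket p (y_var i)) is"
  "ad_ys p (is @ [i]) = fa_bracket (ad_ys p is) (y_var i)"
  by (auto simp: ad_ys_def)

lemma left_normed_simps [simp]:
  "left_normed [p] = p" "ps \<noteq> [] \<Longrightarrow> left_normed (ps @ [p]) = fa_bracket (left_normed ps) p"
  by (cases ps; auto simp: left_normed_def)+

lemma zy_bracket_simps [simp]:
  "zy_bracket [(v, is)] = ad_ys (fa_var v) is"
  "t \<noteq> [] \<Longrightarrow> zy_bracket (t @ [(v, is)]) = fa_bracket (zy_bracket t) (ad_ys (fa_var v) is)"
  by (auto simp: zy_bracket_def)

lemma zy_terms_induct [consumes 1, case_names single snoc]:
  assumes "t \<in> zy_terms n"
    and "\<And>v is. 0 < fst v \<Longrightarrow> fst v < n \<Longrightarrow> P [(v, is)]"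
    and "\<And>t v is. t \<in> zy_terms n \<Longrightarrow> t \<noteq> [] \<Longrightarrow> 0 < fst v \<Longrightarrow> fst v < n \<Longrightarrow> P t \<Longrightarrow> P (t @ [(v, is)])"
  shows "P t"
  using assms(1)
proof (induction t rule: rev_induct)
  case (snoc x t)
  obtain v "is" where x: "x = (v, is)" by fastforce
  show ?case
  proof (cases "t = []")
    case True
    then show ?thesis using snoc.prems assms(2) by (auto simp: zy_terms_def x)
  next
    case False
    then have "t \<in> zy_terms n" "0 < fst v" "fst v < n"
      using snoc.prems by (auto simp: zy_terms_def x)
    then show ?thesis using False snoc.IH assms(3) by (simp add: x)
  qed
qed (auto simp: zy_terms_def)

lemma zy_terms_snoc:
  "t \<in> zy_terms n \<Longrightarrow> 0 < fst v \<Longrightarrow> fst v < n \<Longrightarrow> t @ [(v, is)] \<in> zy_terms n"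
  by (auto simp: zy_terms_def)

lemma y_var_freeLie: "n \<ge> 1 \<Longrightarrow> y_var i \<in> freeLie n"
  by (simp add: y_var_def freeLie.gen)

lemma ad_ys_freeLie: "n \<ge> 1 \<Longrightarrow> p \<in> freeLie n \<Longrightarrow> ad_ys p is \<in> freeLie n"
  by (induction "is" rule: rev_induct) (simp_all add: freeLie.bracket y_var_freeLie)

lemma zy_bracket_freeLie:
  assumes "n \<ge> 1" "t \<in> zy_terms n"
  shows "zy_bracket t \<in> freeLie n"
  using assms(2)
  by (induction rule: zy_terms_induct)
    (simp_all add: freeLie.bracket ad_ys_freeLie[OF assms(1)] freeLie_var)

lemma zdeg_ad_ys: "degree_on zdeg m p \<Longrightarrow> degree_on zdeg m (ad_ys p is)"
proof (induction "is" rule: rev_induct)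
  case (snoc i "is")
  have "degree_on zdeg 0 (y_var i)"
    by (auto simp: degree_on_def y_var_def fa_var_def zdeg_def fun_eq_iff fa_apply)
  from zdeg_bracket[OF snoc.IH[OF snoc.prems] this] show ?case by simp
qed simp

lemma zdeg_var: "degree_on zdeg (zdeg [v]) (fa_var v)"
  by (auto simp: degree_on_def fa_var_def)

lemma zdeg_zy_bracket: "t \<in> zy_terms n \<Longrightarrow> degree_on zdeg (zdeg (map fst t)) (zy_bracket t)"
proof (induction rule: zy_terms_induct)
  case (single v "is")
  then show ?case by (auto intro: zdeg_ad_ys zdeg_var)
next
  case (snoc t v "is")
  then show ?case by (auto simp: zdeg_append intro!: zdeg_bracket zdeg_ad_ys zdeg_var)
qed

lemma homog_ad_ys:
  assumes "g < n" "homog n g p"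
  shows "homog n g (ad_ys p is)"
  using assms(2)
proof (induction "is" rule: rev_induct)
  case (snoc i "is")
  have "homog n 0 (y_var i)" using assms by (auto simp: y_var_def intro: homog_var)
  from homog_bracket[OF snoc.IH[OF snoc.prems] this] show ?case using assms by simp
qed simp

lemma homog_zy_bracket:
  "t \<in> zy_terms n \<Longrightarrow> homog n (sum_list (map (\<lambda>x. fst (fst x)) t) mod n) (zy_bracket t)"
proof (induction rule: zy_terms_induct)
  case (single v "is")
  then show ?case by (auto intro: homog_ad_ys homog_var_fst)
next
  case (snoc t v "is")
  have "homog n (fst v) (ad_ys (fa_var v) is)"
    using snoc by (auto intro: homog_ad_ys homog_var_fst)
  from homog_bracket[OF snoc.IH this] show ?case using snoc.hyps by (simp add: mod_simps)
qed

lemma span_bracket: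
  assumes "\<And>a b. a \<in> A \<Longrightarrow> b \<in> B \<Longrightarrow> fa_bracket a b \<in> fa.span C"
    and "p \<in> fa.span A" "q \<in> fa.span B"
  shows "fa_bracket p q \<in> fa.span C"
proof -
  have "fa_bracket p b \<in> fa.span C" if "b \<in> B" for b
    using assms(2)
    by (induction rule: fa.span_induct_alt)
      (auto simp: fa_bracket_add_left fa_bracket_scale_left assms(1) that intro!: fa.span_add fa.span_scale fa.span_zero)
  note * = this
  show ?thesis
    using assms(3)
    by (induction rule: fa.span_induct_alt)
      (auto simp: * fa_bracket_add_right fa_bracket_scale_right intro!: fa.span_add fa.span_scale fa.span_zero)
qed

text \<open>Single identities suffice, since substitution carries them to all elements of the same
  degrees; the indices 0 and 1 keep the two variables apart when g = h.\<close>

locale base_ideal =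
  fixes n :: nat and K :: "'f::field fa set"
  assumes n: "n \<ge> 1" and K: "T_ideal n K"
    and y_comm: "fa_bracket (fa_var (0, 0)) (fa_var (0, 1)) \<in> K"
    and z_nilp: "\<And>g h. 0 < g \<Longrightarrow> g < n \<Longrightarrow> 0 < h \<Longrightarrow> h < n \<Longrightarrow> n \<le> g + h \<Longrightarrow>
      fa_bracket (fa_var (g, 0)) (fa_var (h, 1)) \<in> K"
begin

lemma y_var_bracket: "fa_bracket (y_var i) (y_var j) \<in> K"
proof -
  let ?\<rho> = "\<lambda>v. if v = (0, 0) then (0, i) else if v = (0, 1) then (0, j) else v"
  have "fsubst (\<lambda>v. fa_var (?\<rho> v)) (fa_bracket (fa_var (0, 0)) (fa_var (0, 1))) \<in> K"
    by (rule T_ideal_subst[OF K y_comm graded_endo_rename]) auto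
  then show ?thesis by (simp add: fsubst_bracket y_var_def)
qed

lemma bracket_degree_ge:
  assumes "u \<in> freeLie n" "v \<in> freeLie n" "homog n g u" "homog n h v"
    and "0 < g" "g < n" "0 < h" "h < n" "n \<le> g + h"
  shows "fa_bracket u v \<in> K"
proof -
  let ?\<sigma> = "\<lambda>x. if x = (g, 0) then u else if x = (h, 1) then v else fa_var x"
  have "fsubst ?\<sigma> (fa_bracket (fa_var (g, 0)) (fa_var (h, 1))) \<in> K"
    using assms
    by (intro T_ideal_subst[OF K z_nilp graded_endoI]) (auto intro: freeLie.gen homog_var)
  then show ?thesis by (simp add: fsubst_bracket)
qed

text \<open>Degrees are added as naturals, without reduction mod \<open>n\<close>. At the first
  prefix whose sum reaches \<open>n\<close>, the bracket joins two homogeneous elements of degrees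
  below \<open>n\<close> and falls into \<open>K\<close>; longer brackets follow since
  \<open>K\<close> is an ideal.\<close>

lemma zy_bracket_degree_ge:
  "t \<in> zy_terms n \<Longrightarrow> n \<le> sum_list (map (\<lambda>x. fst (fst x)) t) \<Longrightarrow> zy_bracket t \<in> K"
proof (induction rule: zy_terms_induct)
  case (snoc t v "is")
  have v: "ad_ys (fa_var v) is \<in> freeLie n"
    using snoc n by (auto intro: ad_ys_freeLie freeLie_var)
  show ?case
  proof (cases "n \<le> sum_list (map (\<lambda>x. fst (fst x)) t)")
    case True
    then show ?thesis using snoc v by (auto intro: T_ideal_bracket[OF K])
  next
    case False
    have "0 < sum_list (map (\<lambda>x. fst (fst x)) t)"
      using snoc.hyps by (cases t) (auto simp: zy_terms_def)
    moreover have "homog n (sum_list (map (\<lambda>x. fst (fst x)) t)) (zy_bracket t)"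
      using homog_zy_bracket[OF snoc.hyps(1)] False by simp
    moreover have "homog n (fst v) (ad_ys (fa_var v) is)"
      using snoc by (auto intro: homog_ad_ys homog_var_fst)
    ultimately have "fa_bracket (zy_bracket t) (ad_ys (fa_var v) is) \<in> K"
      using False snoc zy_bracket_freeLie[OF n snoc.hyps(1)] v
      by (intro bracket_degree_ge) auto
    then show ?thesis using snoc.hyps by simp
  qed
qed auto

abbreviation zy_span :: "'f fa set" where
  "zy_span \<equiv> fa.span (zy_bracket ` zy_terms n)"

lemma zy_span_bracket_single:
  assumes "x \<in> zy_span" "0 < fst v" "fst v < n"
  shows "fa_bracket x (ad_ys (fa_var v) is) \<in> zy_span"
proof (rule span_bracket[OF _ assms(1) fa.span_base[OF singletonI]])
  fix a b :: "'f fa"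
  assume "a \<in> zy_bracket ` zy_terms n" "b \<in> {ad_ys (fa_var v) is}"
  then obtain t where t: "t \<in> zy_terms n" "a = zy_bracket t" "b = ad_ys (fa_var v) is" by auto
  then have "t \<noteq> []" by (auto simp: zy_terms_def)
  then have "fa_bracket a b = zy_bracket (t @ [(v, is)])" using t by simp
  then show "fa_bracket a b \<in> zy_span"
    using zy_terms_snoc[OF t(1) assms(2,3)] by (auto intro: fa.span_base)
qed

text \<open>By the derivation rule, y_i either extends the last entry or acts on the shorter
  bracket, to which induction applies.\<close>

lemma zy_bracket_y_var: "t \<in> zy_terms n \<Longrightarrow> fa_bracket (zy_bracket t) (y_var i) \<in> zy_span"
proof (induction rule: zy_terms_induct)
  case (single v "is")
  then have "[(v, is @ [i])] \<in> zy_terms n" by (auto simp: zy_terms_def)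
  from fa.span_base[OF imageI[OF this, of zy_bracket]] show ?case by simp
next
  case (snoc t v "is")
  have e: "fa_bracket (zy_bracket (t @ [(v, is)])) (y_var i) =
    fa_bracket (fa_bracket (zy_bracket t) (y_var i)) (ad_ys (fa_var v) is) + zy_bracket (t @ [(v, is @ [i])])"
    using snoc.hyps by (simp add: fa_bracket_bracket_left[of "zy_bracket t" "ad_ys (fa_var v) is" "y_var i"])
  have "zy_bracket (t @ [(v, is @ [i])]) \<in> zy_span"
    using snoc.hyps by (intro fa.span_base imageI zy_terms_snoc)
  then show ?case
    unfolding e by (intro fa.span_add zy_span_bracket_single[OF snoc.IH snoc.hyps(3,4)])
qed

text \<open>Jacobi gives [x, [t, a]] = [[x, t], a] - [[x, a], t]; \<open>x\<close> is kept arbitrary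
  because induction is also applied to [x, a].\<close>

lemma zy_span_bracket_term:
  "t \<in> zy_terms n \<Longrightarrow> x \<in> zy_span \<Longrightarrow> fa_bracket x (zy_bracket t) \<in> zy_span"
proof (induction arbitrary: x rule: zy_terms_induct)
  case (single v "is")
  then show ?case using zy_span_bracket_single by simp
next
  case (snoc t v "is")
  let ?a = "ad_ys (fa_var v) is"
  have "fa_bracket x (zy_bracket (t @ [(v, is)])) =
     fa_bracket (fa_bracket x (zy_bracket t)) ?a - fa_bracket (fa_bracket x ?a) (zy_bracket t)"
    using snoc.hyps fa_bracket_bracket_left[of x "zy_bracket t" ?a] by simp
  then show ?case
    using snoc zy_span_bracket_single by (simp add: fa.span_diff)
qed

text \<open>The span contains the variables, and it is closed under brackets because the brackets of
  any two generators lie in it.\<close>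

lemma freeLie_span: "freeLie n \<subseteq> fa.span (range y_var \<union> zy_bracket ` zy_terms n \<union> K)"
proof
  let ?G = "range y_var \<union> zy_bracket ` zy_terms n \<union> K"
  have G: "?G \<subseteq> freeLie n"
    using T_ideal_subset[OF K] y_var_freeLie[OF n] zy_bracket_freeLie[OF n] by auto
  have LN: "zy_span \<subseteq> fa.span ?G"
    by (intro fa.span_mono) auto
  have KG: "K \<subseteq> fa.span ?G" by (auto intro: fa.span_base)
  have br: "fa_bracket a b \<in> fa.span ?G" if ab: "a \<in> ?G" "b \<in> ?G" for a b
  proof -
    consider "a \<in> K" | "b \<in> K" | i j where "a = y_var i" "b = y_var j"
      | i t where "a = y_var i" "t \<in> zy_terms n" "b = zy_bracket t"
      | i t where "b = y_var i" "t \<in> zy_terms n" "a = zy_bracket t"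
      | s t where "s \<in> zy_terms n" "t \<in> zy_terms n" "a = zy_bracket s" "b = zy_bracket t"
      using ab by blast
    then show ?thesis
    proof cases
      case 1
      then show ?thesis using T_ideal_bracket[OF K, of a b] ab(2) G KG by blast
    next
      case 2
      then show ?thesis using T_ideal_bracket_right[OF K, of b a] ab(1) G KG by blast
    next
      case 3
      then show ?thesis using y_var_bracket KG by blast
    next
      case 4
      then have "fa_bracket b a \<in> fa.span ?G" using zy_bracket_y_var LN by blast
      from fa.span_neg[OF this] show ?thesis by (metis fa_bracket_anticomm)
    next
      case 5
      then show ?thesis using zy_bracket_y_var LN by blast
    next
      case 6
      then show ?thesis using zy_span_bracket_term[of t a] LN by (blast intro: fa.span_base)
    qed
  qed
  fix p :: "'f fa" assume "p \<in> freeLie n"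
  then show "p \<in> fa.span ?G"
  proof (induction rule: freeLie_induct)
    case (var g i)
    show ?case
    proof (cases "g = 0")
      case True
      then have "fa_var (g, i) = y_var i" by (simp add: y_var_def)
      then show ?thesis by (auto intro: fa.span_base)
    next
      case False
      then have "[((g, i), [])] \<in> zy_terms n" using var by (auto simp: zy_terms_def)
      moreover have "fa_var (g, i) = zy_bracket [((g, i), [])]" by simp
      ultimately show ?thesis by (intro fa.span_base) blast
    qed
  next
    case (bracket p q)
    show ?case by (rule span_bracket[OF br bracket.IH])
  qed (auto intro: fa.span_add fa.span_scale)
qed

text \<open>Projection to multidegree \<open>m\<close> keeps or kills each y_i and each bracket, as
  these are homogeneous, and it preserves \<open>K\<close> because the field is infinite.\<close>

lemma homogeneous_span:
  assumes inf: "infinite (UNIV :: 'f set)" and p: "p \<in> freeLie n" "degree_on zdeg m p"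
  shows "p \<in> fa.span ((if m = 0 then range y_var else {}) \<union>
      zy_bracket ` {t \<in> zy_terms n. zdeg (map fst t) = m} \<union> K)" (is "_ \<in> fa.span ?B")
proof -
  have "zdeg_part m a \<in> fa.span ?B" if a: "a \<in> range y_var \<union> zy_bracket ` zy_terms n \<union> K" for a
  proof -
    consider i where "a = y_var i" | t where "t \<in> zy_terms n" "a = zy_bracket t" | "a \<in> K"
      using a by blast
    then show ?thesis
    proof cases
      case 1
      have "degree_on zdeg 0 (y_var i :: 'f fa)"
        by (auto simp: degree_on_def y_var_def fa_var_def zdeg_def fun_eq_iff fa_apply)
      from zdeg_part_degree_on[OF this, of m] show ?thesis
        using 1 by (auto intro: fa.span_base fa.span_zero)
    next
      case 2
      have "degree_on zdeg (zdeg (map fst t)) (zy_bracket t :: 'f fa)"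
        using zdeg_zy_bracket[OF 2(1)] .
      from zdeg_part_degree_on[OF this, of m] show ?thesis
        using 2 by (auto intro: fa.span_base fa.span_zero)
    next
      case 3
      then show ?thesis using T_ideal_zdeg_part[OF inf K] by (auto intro: fa.span_base)
    qed
  qed
  note gens = this
  have "p \<in> fa.span (range y_var \<union> zy_bracket ` zy_terms n \<union> K)"
    using freeLie_span p(1) by blast
  then have "zdeg_part m p \<in> fa.span ?B"
    by (induction rule: fa.span_induct_alt)
      (simp_all only: zdeg_part_add zdeg_part_scale zdeg_part_zero gens fa.span_add fa.span_scale fa.span_zero)
  then show ?thesis using zdeg_part_degree_on[OF p(2), of m] by simp
qed

section \<open>Reordering the y's modulo K\<close>

lemma bracket_cong:
  assumes "u - u' \<in> K" "v - v' \<in> K" "v \<in> freeLie n" "u' \<in> freeLie n"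
  shows "fa_bracket u v - fa_bracket u' v' \<in> K"
proof -
  have "fa_bracket u v - fa_bracket u' v' = fa_bracket (u - u') v + fa_bracket u' (v - v')"
    by (simp add: fa_bracket_diff_left fa_bracket_diff_right)
  then show ?thesis
    using assms by (simp add: T_ideal_add[OF K] T_ideal_bracket[OF K] T_ideal_bracket_right[OF K])
qed

lemma K_trans: "p - q \<in> K \<Longrightarrow> q - r \<in> K \<Longrightarrow> p - r \<in> K"
  using T_ideal_add[OF K, of "p - q" "q - r"] by simp

lemma K_sym: "p - q \<in> K \<Longrightarrow> q - p \<in> K"
  using T_ideal_neg[OF K, of "p - q"] by simp

lemma ad_ys_cong: "p - q \<in> K \<Longrightarrow> q \<in> freeLie n \<Longrightarrow> ad_ys p is - ad_ys q is \<in> K"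
  by (induction "is" rule: rev_induct)
    (auto intro!: bracket_cong y_var_freeLie n ad_ys_freeLie T_ideal_zero[OF K])

text \<open>Exchanging the neighbours y_j and y_i changes [[u, y_j], y_i] by [u, [y_j, y_i]], which
  lies in \<open>K\<close>.\<close>

lemma ad_ys_move_front:
  assumes "p \<in> freeLie n"
  shows "ad_ys p (xs @ [i]) - ad_ys p (i # xs) \<in> K"
proof (induction xs rule: rev_induct)
  case Nil
  show ?case using T_ideal_zero[OF K] by (simp add: ad_ys_def)
next
  case (snoc j xs)
  let ?u = "ad_ys p xs"
  have u: "?u \<in> freeLie n" using ad_ys_freeLie[OF n assms] .
  have "fa_bracket (fa_bracket ?u (y_var j)) (y_var i) - fa_bracket (fa_bracket ?u (y_var i)) (y_var j)
      = fa_bracket ?u (fa_bracket (y_var j) (y_var i))"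
    using fa_bracket_bracket_left[of ?u "y_var j" "y_var i"] by simp
  then have "ad_ys p ((xs @ [j]) @ [i]) - ad_ys p ((xs @ [i]) @ [j]) \<in> K"
    unfolding ad_ys_simps using y_var_bracket u by (simp add: T_ideal_bracket_right[OF K])
  moreover have "ad_ys p ((xs @ [i]) @ [j]) - ad_ys p ((i # xs) @ [j]) \<in> K"
    unfolding ad_ys_simps(3) using snoc.IH assms
    by (intro bracket_cong y_var_freeLie n ad_ys_freeLie) (auto intro: T_ideal_zero[OF K])
  ultimately show ?case using K_trans by simp
qed

lemma ad_ys_append: "ad_ys p (xs @ ys) = ad_ys (ad_ys p xs) ys"
  by (simp add: ad_ys_def)

text \<open>The first entry of \<open>xs\<close> is located in \<open>ys\<close> and moved to the
  front; induction continues from [p, y_i], so \<open>p\<close> must be arbitrary.\<close>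

lemma ad_ys_perm:
  "p \<in> freeLie n \<Longrightarrow> mset xs = mset ys \<Longrightarrow> ad_ys p xs - ad_ys p ys \<in> K"
proof (induction xs arbitrary: p ys)
  case Nil
  then show ?case using T_ideal_zero[OF K] by simp
next
  case (Cons i xs)
  then obtain us vs where ys: "ys = us @ i # vs"
    by (metis list.set_intros(1) mset_eq_setD split_list)
  have "ad_ys p (i # xs) - ad_ys p (i # us @ vs) \<in> K"
    using Cons.IH[OF freeLie.bracket[OF Cons.prems(1) y_var_freeLie[OF n]], of "us @ vs"] Cons.prems ys
    by simp
  moreover have "ad_ys p ys - ad_ys p (i # us @ vs) \<in> K"
    using ad_ys_cong[OF ad_ys_move_front[OF Cons.prems(1), of us i] ad_ys_freeLie[OF n Cons.prems(1)], of vs]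
    by (simp add: ys ad_ys_append[symmetric] del: ad_ys_simps(2,3))
  ultimately show ?case using K_trans K_sym by blast
qed

lemma zy_bracket_cong:
  assumes "\<And>v. v \<in> set s \<Longrightarrow> mset (f v) = mset (g v)" "s \<noteq> []" "\<And>v. v \<in> set s \<Longrightarrow> 0 < fst v \<and> fst v < n"
  shows "zy_bracket (map (\<lambda>v. (v, f v)) s) - zy_bracket (map (\<lambda>v. (v, g v)) s) \<in> K"
  using assms
proof (induction s rule: rev_induct)
  case (snoc v s)
  have 1: "ad_ys (fa_var v) (f v) - ad_ys (fa_var v) (g v) \<in> K"
    using snoc.prems(1)[of v] snoc.prems(3)[of v] by (intro ad_ys_perm freeLie_var) simp_all
  show ?case
  proof (cases "s = []")
    case False
    then have "map (\<lambda>v. (v, g v)) s \<in> zy_terms n"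
      using snoc.prems by (auto simp: zy_terms_def)
    moreover have "zy_bracket (map (\<lambda>v. (v, f v)) s) - zy_bracket (map (\<lambda>v. (v, g v)) s) \<in> K"
      using False snoc by simp
    ultimately show ?thesis
      using 1 False snoc.prems(3)[of v] by (auto intro!: bracket_cong ad_ys_freeLie n zy_bracket_freeLie freeLie_var)
  qed (use 1 in simp)
qed simp

end

lemma fsubst_zy_bracket:
  fixes \<sigma> :: "var \<Rightarrow> 'f::field fa"
  assumes "n \<ge> 1" "graded_endo n \<sigma>" "t \<in> zy_terms n"
    and "\<And>v is. (v, is) \<in> set t \<Longrightarrow> fsubst \<sigma> (ad_ys (fa_var v) is) = ad_ys (fa_var v) (f v is)"
  shows "fsubst \<sigma> (zy_bracket t) = zy_bracket (map (\<lambda>(v, is). (v, f v is)) t)"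
  using assms(3,4)
proof (induction rule: zy_terms_induct)
  case (snoc t v "is")
  have "finite (supp (ad_ys (fa_var v) is :: 'f fa))" "finite (supp (zy_bracket t :: 'f fa))"
    using snoc assms(1)
    by (auto intro!: finite_supp_freeLie[of _ n] ad_ys_freeLie freeLie_var zy_bracket_freeLie)
  then show ?case
    using snoc by (simp add: fsubst_bracket)
qed auto

lemma fsubst_ad_ys:
  assumes "n \<ge> 1" "p \<in> freeLie n"
  shows "fsubst \<sigma> (ad_ys p is) = foldl (\<lambda>q i. fa_bracket q (\<sigma> (0, i))) (fsubst \<sigma> p) is"
proof (induction "is" rule: rev_induct)
  case (snoc i "is")
  then show ?case
    using finite_supp_freeLie[OF ad_ys_freeLie[OF assms, of "is"]]
    by (simp add: fsubst_bracket y_var_def)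
qed simp

section \<open>Noetherianity of the multilinear components\<close>

definition y_indices :: "(nat \<times> var) multiset \<Rightarrow> var \<Rightarrow> nat multiset" where
  "y_indices \<alpha> v = image_mset fst {#x \<in># \<alpha>. snd x = v#}"

lemma y_indices_add: "y_indices (\<alpha> + \<beta>) v = y_indices \<alpha> v + y_indices \<beta> v"
  by (simp add: y_indices_def)

lemma y_indices_reindex: "y_indices (reindex \<pi> \<alpha>) v = image_mset \<pi> (y_indices \<alpha> v)"
  by (induction \<alpha>) (auto simp: y_indices_def reindex_def)

text \<open>When a term is recorded as a monomial, the y's of each z can be read off again up to
  order, because the z's are distinct.\<close>

lemma y_indices_concat:
  assumes "distinct (map fst t)" "(v, is) \<in> set t"
  shows "y_indices (mset (concat (map (\<lambda>(v, is). map (\<lambda>i. (i, v)) is) t))) v = mset is"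
proof -
  have y: "y_indices (mset (map (\<lambda>i. (i, u)) is)) v = (if u = v then mset is else {#})" for u v "is"
    by (induction "is") (auto simp: y_indices_def)
  have z: "y_indices (mset (concat (map (\<lambda>(v, is). map (\<lambda>i. (i, v)) is) t))) v = {#}"
    if "v \<notin> fst ` set t" for t
    using that
    by (induction t) (auto simp: y_indices_add y split: if_splits, auto simp: y_indices_def)
  show ?thesis
    using assms
  proof (induction t)
    case (Cons x t)
    obtain u js where x: "x = (u, js)" by fastforce
    show ?case
    proof (cases "u = v")
      case True
      then have "v \<notin> fst ` set t" using Cons.prems(1) x by simp
      moreover from this have "js = is" using Cons.prems(2) x by force
      ultimately show ?thesis
        using z[of t] by (simp only: x True list.map concat.simps mset_append y_indices_add prod.case y) simp
    next
      case False
      then have "y_indices (mset (concat (map (\<lambda>(v, is). map (\<lambda>i. (i, v)) is) t))) v = mset is"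
        using Cons x by auto
      with False show ?thesis
        by (simp only: x list.map concat.simps mset_append y_indices_add prod.case y) simp
    qed
  qed simp
qed

text \<open>If no finite set worked, one could keep choosing an element of \<open>A\<close> above
  none of the earlier ones, and this sequence would contradict the assumption.\<close>

lemma finite_basis:
  assumes "\<And>f :: nat \<Rightarrow> 'a. (\<And>i. f i \<in> A) \<Longrightarrow> \<exists>i j. i < j \<and> R (f i) (f j)"
  shows "\<exists>B\<subseteq>A. finite B \<and> (\<forall>a\<in>A. \<exists>b\<in>B. R b a)"
proof (rule ccontr)
  assume neg: "\<not> ?thesis"
  define g where "g B = (SOME a. a \<in> A \<and> (\<forall>b\<in>B. \<not> R b a))" for B
  have g: "g B \<in> A \<and> (\<forall>b\<in>B. \<not> R b (g B))" if B: "finite B" "B \<subseteq> A" for B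
  proof -
    have "\<not> (\<forall>a\<in>A. \<exists>b\<in>B. R b a)"
    proof
      assume "\<forall>a\<in>A. \<exists>b\<in>B. R b a"
      with B have "\<exists>B\<subseteq>A. finite B \<and> (\<forall>a\<in>A. \<exists>b\<in>B. R b a)"
        by (intro exI[of _ B] conjI)
      with neg show False by contradiction
    qed
    then have "\<exists>a. a \<in> A \<and> (\<forall>b\<in>B. \<not> R b a)" by blast
    from someI_ex[OF this] show ?thesis unfolding g_def .
  qed
  define Bs where "Bs = rec_nat {} (\<lambda>_ B. insert (g B) B)"
  have Bs: "Bs 0 = {}" "\<And>k. Bs (Suc k) = insert (g (Bs k)) (Bs k)" by (auto simp: Bs_def)
  have fin: "finite (Bs k) \<and> Bs k \<subseteq> A" for k
    by (induction k) (use g in \<open>auto simp: Bs\<close>)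
  have mem: "g (Bs i) \<in> Bs j" if "i < j" for i j
    using that by (induction j) (auto simp: Bs less_Suc_eq)
  obtain i j where "i < j" "R (g (Bs i)) (g (Bs j))"
    using assms[of "\<lambda>i. g (Bs i)"] g fin by blast
  then show False using g[of "Bs j"] fin mem by blast
qed

text \<open>The list \<open>ps\<close> holds the orderings of \<open>V\<close>; coding an ordering
  by its position makes monomials pairs that are well-ordered lexicographically.\<close>

locale multilinear_part = base_ideal +
  fixes V :: "var set" and ps :: "var list list"
  assumes V: "finite V" "V \<noteq> {}" "\<And>v. v \<in> V \<Longrightarrow> 0 < fst v \<and> fst v < n"
    and ps: "set ps = {s. distinct s \<and> set s = V}"
begin

text \<open>The monomial \<open>(\<alpha>, q)\<close> stands for the left-normed bracket of the variables of \<open>V\<close> in the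
  \<open>q\<close>-th order, where \<open>\<alpha>\<close> lists the pairs \<open>(i, v)\<close> such that \<open>y\<^sub>i\<close> acts on \<open>v\<close>.\<close>

definition monomials :: "((nat \<times> var) multiset \<times> nat) set" where
  "monomials = {(\<alpha>, q). snd ` set_mset \<alpha> \<subseteq> V \<and> q < length ps}"

definition e_term :: "(nat \<times> var) multiset \<times> nat \<Rightarrow> (var \<times> nat list) list" where
  "e_term s = map (\<lambda>v. (v, sorted_list_of_multiset (y_indices (fst s) v))) (ps ! snd s)"

definition e :: "(nat \<times> var) multiset \<times> nat \<Rightarrow> 'a fa" where
  "e s = zy_bracket (e_term s)"

lemma ps_nth: "q < length ps \<Longrightarrow> distinct (ps ! q) \<and> set (ps ! q) = V"
  using ps nth_mem by blast

lemma e_term_zy: "s \<in> monomials \<Longrightarrow> e_term s \<in> zy_terms n"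
  using V(2,3) ps_nth[of "snd s"] by (force simp: monomials_def e_term_def zy_terms_def)

lemma e_freeLie: "s \<in> monomials \<Longrightarrow> e s \<in> freeLie n"
  unfolding e_def by (intro zy_bracket_freeLie n e_term_zy)

text \<open>In a bracket of this multidegree each element of \<open>V\<close> occurs once and no
  other z does, so its z's form an ordering from \<open>ps\<close>; the y's can be sorted modulo
  \<open>K\<close>.\<close>

lemma multilinear_span:
  assumes inf: "infinite (UNIV :: 'a set)" and p: "p \<in> freeLie n"
    "degree_on zdeg (\<lambda>v. if v \<in> V then 1 else 0) p"
  shows "p \<in> fa.span (e ` monomials \<union> K)"
proof -
  let ?m = "\<lambda>v. if v \<in> V then 1 else 0 :: nat"
  obtain v0 where "v0 \<in> V" using V(2) by blast
  have m0: "?m \<noteq> 0"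
  proof
    assume "?m = 0"
    from fun_cong[OF this, of v0] show False using \<open>v0 \<in> V\<close> by (simp add: fa_apply)
  qed
  from homogeneous_span[OF inf p] m0 have hs: "p \<in> fa.span (zy_bracket ` {t \<in> zy_terms n. zdeg (map fst t) = ?m} \<union> K)"
    by simp
  have "zy_bracket t \<in> fa.span (e ` monomials \<union> K)" if t: "t \<in> zy_terms n" "zdeg (map fst t) = ?m" for t
  proof -
    let ?s = "map fst t"
    have cnt: "count_list ?s v = ?m v" for v
    proof (cases "fst v = 0")
      case True
      then have "v \<notin> set ?s" "v \<notin> V" using t(1) V(3)[of v] by (auto simp: zy_terms_def)
      then show ?thesis by (simp add: count_list_0_iff)
    next
      case False
      then show ?thesis using fun_cong[OF t(2), of v] by (simp add: zdeg_def)
    qed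
    then have sV: "set ?s = V"
      by (metis (mono_tags, lifting) count_list_0_iff set_eqI zero_neq_one)
    have d: "distinct ?s"
      unfolding distinct_count_atmost_1 count_mset cnt sV by simp
    obtain q where q: "q < length ps" "ps ! q = ?s"
      using ps d sV by (metis (mono_tags, lifting) in_set_conv_nth mem_Collect_eq)
    define \<alpha> where "\<alpha> = mset (concat (map (\<lambda>(v, is). map (\<lambda>i. (i, v)) is) t))"
    have \<alpha>: "(\<alpha>, q) \<in> monomials"
      using q(1) sV by (auto simp: monomials_def \<alpha>_def) (metis fst_conv image_eqI)
    \<comment> \<open>Distinct first components allow \<open>t\<close> to be read as a function of
      them, the shape that \<open>zy_bracket_cong\<close> expects.\<close>
    have te: "t = map (\<lambda>v. (v, the (map_of t v))) ?s"
      using d by (auto simp: map_idI intro!: nth_equalityI)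
        (metis d map_of_is_SomeI nth_mem option.sel prod.collapse)
    have "zy_bracket (map (\<lambda>v. (v, the (map_of t v))) ?s) - zy_bracket (map (\<lambda>v. (v, sorted_list_of_multiset (y_indices \<alpha> v))) ?s) \<in> K"
    proof (rule zy_bracket_cong)
      fix v assume "v \<in> set ?s"
      then obtain "is" where "(v, is) \<in> set t" by auto
      then show "mset (the (map_of t v)) = mset (sorted_list_of_multiset (y_indices \<alpha> v))"
        using y_indices_concat[OF d] d by (simp add: \<alpha>_def)
    next
      show "?s \<noteq> []" using t(1) by (simp add: zy_terms_def)
    next
      show "0 < fst v \<and> fst v < n" if "v \<in> set ?s" for v using that sV V(3) by blast
    qed
    then have "zy_bracket t - e (\<alpha>, q) \<in> K"
      using te q(2) by (simp add: e_def e_term_def)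
    then have "(zy_bracket t - e (\<alpha>, q)) + e (\<alpha>, q) \<in> fa.span (e ` monomials \<union> K)"
      using \<alpha> by (intro fa.span_add) (auto intro: fa.span_base)
    then show ?thesis by simp
  qed
  then have "zy_bracket ` {t \<in> zy_terms n. zdeg (map fst t) = ?m} \<union> K \<subseteq> fa.span (e ` monomials \<union> K)"
    by (auto intro: fa.span_base)
  from fa.span_minimal[OF this fa.subspace_span] hs show ?thesis by blast
qed

text \<open>One operator is applied to \<open>J\<close>, to \<open>K\<close> and to an arbitrary
  T-ideal above \<open>K\<close>, so it must preserve all T-ideals. Linearity is asked only on the
  free Lie algebra, where supports are finite and \<open>fsubst\<close> behaves as a
  homomorphism.\<close>

definition linear_operator :: "('a fa \<Rightarrow> 'a fa) \<Rightarrow> bool" where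
  "linear_operator \<phi> \<longleftrightarrow> (\<forall>J. T_ideal n J \<longrightarrow> (\<forall>x\<in>J. \<phi> x \<in> J)) \<and> (\<forall>x\<in>freeLie n. \<phi> x \<in> freeLie n) \<and>
    (\<forall>x\<in>freeLie n. \<forall>y\<in>freeLie n. \<phi> (x + y) = \<phi> x + \<phi> y) \<and>
    (\<forall>c. \<forall>x\<in>freeLie n. \<phi> (c *\<^sub>F x) = c *\<^sub>F \<phi> x)"

definition realizes :: "('a fa \<Rightarrow> 'a fa) \<Rightarrow> ((nat \<times> var) multiset \<times> nat \<Rightarrow> (nat \<times> var) multiset \<times> nat) \<Rightarrow> bool" where
  "realizes \<phi> a \<longleftrightarrow> linear_operator \<phi> \<and> (\<forall>s\<in>monomials. a s \<in> monomials \<and> \<phi> (e s) - e (a s) \<in> K)"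

lemma linear_operator_fsubst: "graded_endo n \<sigma> \<Longrightarrow> linear_operator (fsubst \<sigma>)"
  by (auto simp: linear_operator_def T_ideal_subst fsubst_freeLie fsubst_add fsubst_scale)

lemma linear_operator_diff:
  assumes "linear_operator \<phi>" "x \<in> freeLie n" "y \<in> freeLie n"
  shows "\<phi> (x - y) = \<phi> x - \<phi> y"
proof -
  have "\<phi> (x + (-1) *\<^sub>F y) = \<phi> x + (-1) *\<^sub>F \<phi> y"
    using assms freeLie_scale[of y n "-1"] by (simp only: linear_operator_def)
  then show ?thesis by simp
qed

text \<open>The error of \<phi> remains in \<open>K\<close> under \<psi>, because operators preserve
  T-ideals.\<close>

lemma realizes_comp:
  assumes "realizes \<phi> a" "realizes \<psi> b"
  shows "realizes (\<lambda>x. \<psi> (\<phi> x)) (\<lambda>s. b (a s))"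
proof -
  have lin: "linear_operator \<phi>" "linear_operator \<psi>" using assms by (auto simp: realizes_def)
  have "\<psi> (\<phi> (e s)) - e (b (a s)) \<in> K" if s: "s \<in> monomials" for s
  proof -
    have 1: "a s \<in> monomials" "\<phi> (e s) - e (a s) \<in> K" "\<psi> (e (a s)) - e (b (a s)) \<in> K"
      using assms s by (auto simp: realizes_def)
    have "\<psi> (\<phi> (e s) - e (a s)) \<in> K"
      using lin(2) K 1(2) by (auto simp: linear_operator_def)
    moreover have "\<phi> (e s) \<in> freeLie n"
      using lin(1) e_freeLie[OF s] by (auto simp: linear_operator_def)
    ultimately have "\<psi> (\<phi> (e s)) - \<psi> (e (a s)) \<in> K"
      using linear_operator_diff[OF lin(2) _ e_freeLie[OF 1(1)]] by simp
    with 1(3) show ?thesis using K_trans by blast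
  qed
  moreover have "linear_operator (\<lambda>x. \<psi> (\<phi> x))"
    using lin by (simp add: linear_operator_def)
  ultimately show ?thesis
    using assms by (simp add: realizes_def)
qed

text \<open>The substitution renames the y's by \<pi> and fixes the z's. It may disturb the sorted
  order of the y's, which is harmless modulo \<open>K\<close>.\<close>

lemma realizes_reindex: "\<exists>\<phi>. realizes \<phi> (\<lambda>(\<alpha>, q). (reindex \<pi> \<alpha>, q))"
proof -
  let ?\<rho> = "\<lambda>v. if fst v = 0 then (0, \<pi> (snd v)) else v"
  let ?\<sigma> = "\<lambda>v. fa_var (?\<rho> v) :: 'a fa"
  have \<sigma>: "graded_endo n ?\<sigma>" by (rule graded_endo_rename) auto
  have "(reindex \<pi> \<alpha>, q) \<in> monomials \<and> fsubst ?\<sigma> (e (\<alpha>, q)) - e (reindex \<pi> \<alpha>, q) \<in> K"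
    if s: "(\<alpha>, q) \<in> monomials" for \<alpha> q
  proof
    show r: "(reindex \<pi> \<alpha>, q) \<in> monomials"
      using s by (force simp: monomials_def reindex_def)
    have q: "distinct (ps ! q)" "set (ps ! q) = V" using ps_nth s by (auto simp: monomials_def)
    have "fsubst ?\<sigma> (e (\<alpha>, q)) = zy_bracket (map (\<lambda>(v, is). (v, map \<pi> is)) (e_term (\<alpha>, q)))"
      unfolding e_def
    proof (rule fsubst_zy_bracket[OF n \<sigma> e_term_zy[OF s]])
      fix v "is" assume "(v, is) \<in> set (e_term (\<alpha>, q))"
      then have "v \<in> V" using q by (auto simp: e_term_def)
      then have v: "0 < fst v" "fst v < n" using V(3) by auto
      have "foldl (\<lambda>q i. fa_bracket q (?\<sigma> (0, i))) x is = ad_ys x (map \<pi> is)" for x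
        by (induction "is" arbitrary: x) (auto simp: y_var_def)
      then show "fsubst ?\<sigma> (ad_ys (fa_var v) is) = ad_ys (fa_var v) (map \<pi> is)"
        using v by (simp add: fsubst_ad_ys[OF n freeLie_var])
    qed
    also have "map (\<lambda>(v, is). (v, map \<pi> is)) (e_term (\<alpha>, q)) =
       map (\<lambda>v. (v, map \<pi> (sorted_list_of_multiset (y_indices \<alpha> v)))) (ps ! q)"
      by (simp add: e_term_def)
    finally show "fsubst ?\<sigma> (e (\<alpha>, q)) - e (reindex \<pi> \<alpha>, q) \<in> K"
      unfolding e_def e_term_def fst_conv snd_conv
      using q V by (auto simp: y_indices_reindex intro!: zy_bracket_cong)
  qed
  then show ?thesis
    using linear_operator_fsubst[OF \<sigma>] by (intro exI[of _ "fsubst ?\<sigma>"]) (auto simp: realizes_def)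
qed

text \<open>Replacing the variable \<open>v\<close> by [v, y_i] puts \<open>i\<close> in front of
  the list at \<open>v\<close>; moving it to its sorted place costs an element of
  \<open>K\<close>.\<close>

lemma realizes_add_y:
  assumes "v \<in> V"
  shows "\<exists>\<phi>. realizes \<phi> (\<lambda>(\<alpha>, q). (add_mset (i, v) \<alpha>, q))"
proof -
  let ?\<sigma> = "\<lambda>u. if u = v then fa_bracket (fa_var v) (y_var i) else fa_var u :: 'a fa"
  have v: "0 < fst v" "fst v < n" using V(3) assms by auto
  have "homog n (fst v) (fa_bracket (fa_var v) (y_var i))"
    using homog_bracket[OF homog_var_fst[OF v(2)], of 0 "y_var i"] homog_var[of 0 n i] v
    by (simp add: y_var_def)
  then have \<sigma>: "graded_endo n ?\<sigma>"
    using v by (intro graded_endoI) (auto intro!: freeLie.bracket freeLie_var y_var_freeLie n homog_var)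
  have "(add_mset (i, v) \<alpha>, q) \<in> monomials \<and> fsubst ?\<sigma> (e (\<alpha>, q)) - e (add_mset (i, v) \<alpha>, q) \<in> K"
    if s: "(\<alpha>, q) \<in> monomials" for \<alpha> q
  proof
    show r: "(add_mset (i, v) \<alpha>, q) \<in> monomials"
      using s assms by (auto simp: monomials_def)
    have q: "distinct (ps ! q)" "set (ps ! q) = V" using ps_nth s by (auto simp: monomials_def)
    have "fsubst ?\<sigma> (e (\<alpha>, q)) = zy_bracket (map (\<lambda>(u, is). (u, if u = v then i # is else is)) (e_term (\<alpha>, q)))"
      unfolding e_def
    proof (rule fsubst_zy_bracket[OF n \<sigma> e_term_zy[OF s]])
      fix u "is" assume "(u, is) \<in> set (e_term (\<alpha>, q))"
      then have "u \<in> V" using q by (auto simp: e_term_def)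
      then have u: "0 < fst u" "fst u < n" using V(3) by auto
      have "foldl (\<lambda>q i. fa_bracket q (?\<sigma> (0, i))) x is = ad_ys x is" for x
        using v by (induction "is" arbitrary: x) (auto simp: y_var_def)
      then show "fsubst ?\<sigma> (ad_ys (fa_var u) is) = ad_ys (fa_var u) (if u = v then i # is else is)"
        using u by (simp add: fsubst_ad_ys[OF n freeLie_var])
    qed
    also have "map (\<lambda>(u, is). (u, if u = v then i # is else is)) (e_term (\<alpha>, q)) =
       map (\<lambda>u. (u, if u = v then i # sorted_list_of_multiset (y_indices \<alpha> u)
          else sorted_list_of_multiset (y_indices \<alpha> u))) (ps ! q)"
      by (simp add: e_term_def)
    finally show "fsubst ?\<sigma> (e (\<alpha>, q)) - e (add_mset (i, v) \<alpha>, q) \<in> K"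
      unfolding e_def e_term_def fst_conv snd_conv
      using q V by (auto simp: y_indices_def intro!: zy_bracket_cong)
  qed
  then show ?thesis
    using linear_operator_fsubst[OF \<sigma>] by (intro exI[of _ "fsubst ?\<sigma>"]) (auto simp: realizes_def)
qed

lemma realizes_reindex_add:
  assumes "snd ` set_mset \<gamma> \<subseteq> V"
  shows "\<exists>\<phi>. realizes \<phi> (\<lambda>(\<alpha>, q). (reindex \<pi> \<alpha> + \<gamma>, q))"
  using assms
proof (induction \<gamma>)
  case empty
  then show ?case using realizes_reindex by simp
next
  case (add x \<gamma>)
  obtain i v where x: "x = (i, v)" by (rule prod.exhaust)
  obtain \<phi> where \<phi>: "realizes \<phi> (\<lambda>(\<alpha>, q). (reindex \<pi> \<alpha> + \<gamma>, q))" using add by auto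
  obtain \<psi> where \<psi>: "realizes \<psi> (\<lambda>(\<alpha>, q). (add_mset (i, v) \<alpha>, q))"
    using realizes_add_y[of v i] add.prems x by auto
  from realizes_comp[OF \<phi> \<psi>] show ?case
    by (auto simp: x case_prod_unfold)
qed

section \<open>Leading monomials and divisibility\<close>

definition lower_span :: "(nat \<times> var) multiset \<times> nat \<Rightarrow> 'a fa set" where
  "lower_span t = fa.span (e ` {s \<in> monomials. s < t} \<union> K)"

text \<open>Smaller monomials go to smaller ones, and the errors lie in \<open>K\<close>, which
  every \<open>lower_span\<close> contains.\<close>

lemma realizes_lower_span:
  assumes "realizes \<phi> a" "t \<in> monomials" "\<And>s t. s < t \<Longrightarrow> a s < a t" "x \<in> lower_span t"
  shows "\<phi> x \<in> lower_span (a t)"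
proof -
  have lin: "linear_operator \<phi>" using assms(1) by (simp add: realizes_def)
  have KL: "K \<subseteq> lower_span t" for t by (auto simp: lower_span_def intro: fa.span_base)
  have gen: "b \<in> freeLie n \<and> \<phi> b \<in> lower_span (a t)" if b: "b \<in> e ` {s \<in> monomials. s < t} \<union> K" for b
  proof (cases "b \<in> K")
    case True
    then have "\<phi> b \<in> K" using lin K by (simp add: linear_operator_def)
    then show ?thesis using True KL T_ideal_subset[OF K] by blast
  next
    case False
    then obtain s where s: "s \<in> monomials" "s < t" "b = e s" using b by auto
    then have as: "a s \<in> monomials" "a s < a t" "\<phi> (e s) - e (a s) \<in> K"
      using assms(1,3) by (auto simp: realizes_def)
    have "(\<phi> (e s) - e (a s)) + e (a s) \<in> lower_span (a t)"
      unfolding lower_span_def using as by (intro fa.span_add) (auto intro: fa.span_base)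
    then show ?thesis using s e_freeLie by simp
  qed
  have "x \<in> freeLie n \<and> \<phi> x \<in> lower_span (a t)"
    using assms(4) unfolding lower_span_def[of t]
  proof (induction rule: fa.span_induct_alt)
    case base
    have "\<phi> 0 \<in> K" "0 \<in> K" using lin K T_ideal_zero[OF K] by (auto simp: linear_operator_def)
    then show ?case using KL T_ideal_subset[OF K] by blast
  next
    case (step c b y)
    then have "\<phi> (c *\<^sub>F b + y) = c *\<^sub>F \<phi> b + \<phi> y"
      using lin gen[OF step(1)] freeLie_scale[of b n c] by (simp add: linear_operator_def)
    then show ?case
      using gen[OF step(1)] step by (simp add: lower_span_def fa.span_add fa.span_scale freeLie_add freeLie_scale)
  qed
  then show ?thesis by simp
qed

text \<open>The available operators rename and add y's but never change the order of the z's; hence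
  the second components must agree.\<close>

definition divides :: "(nat \<times> var) multiset \<times> nat \<Rightarrow> (nat \<times> var) multiset \<times> nat \<Rightarrow> bool" where
  "divides s t \<longleftrightarrow> snd s = snd t \<and> (\<exists>\<pi>. strict_mono \<pi> \<and> reindex \<pi> (fst s) \<subseteq># fst t)"

text \<open>The pigeonhole principle gives a subsequence with one fixed ordering of the z's, to
  which \<open>monomials_wqo\<close> applies.\<close>

lemma divides_wqo:
  assumes "\<And>i. f i \<in> monomials"
  shows "\<exists>i j. i < (j::nat) \<and> divides (f i) (f j)"
proof -
  have "range (\<lambda>i. snd (f i)) \<subseteq> {..<length ps}"
    using assms by (auto simp: monomials_def mem_Times_iff)
  then have "finite (range (\<lambda>i. snd (f i)))" using finite_subset by blast
  then obtain k where k: "infinite {i. snd (f i) = snd (f k)}"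
    using pigeonhole_infinite[of UNIV "\<lambda>i. snd (f i)"] by auto
  define r where "r = enumerate {i. snd (f i) = snd (f k)}"
  have r: "strict_mono r" "\<And>i. snd (f (r i)) = snd (f k)"
    using k enumerate_in_set[OF k] by (auto simp: r_def strict_mono_enumerate)
  have "\<exists>i j \<pi>. i < j \<and> strict_mono \<pi> \<and> reindex \<pi> (fst (f (r i))) \<subseteq># fst (f (r j))"
    using assms by (intro monomials_wqo[OF V(1)]) (auto simp: monomials_def case_prod_unfold)
  then obtain i j \<pi> where "i < j" "strict_mono \<pi>" "reindex \<pi> (fst (f (r i))) \<subseteq># fst (f (r j))"
    by blast
  then show ?thesis using r by (intro exI[of _ "r i"] exI[of _ "r j"]) (auto simp: divides_def strict_mono_def)
qed

lemma divides_realizes: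
  assumes "divides s t" "t \<in> monomials"
  obtains \<phi> a where "realizes \<phi> a" "a s = t" "\<And>s t. s < t \<Longrightarrow> a s < a t"
proof -
  obtain \<pi> where \<pi>: "snd s = snd t" "strict_mono \<pi>" "reindex \<pi> (fst s) \<subseteq># fst t"
    using assms by (auto simp: divides_def)
  \<comment> \<open>The quotient monomial, by which the renamed \<open>s\<close> has to be
    multiplied to give \<open>t\<close>.\<close>
  define \<gamma> where "\<gamma> = fst t - reindex \<pi> (fst s)"
  have "snd ` set_mset \<gamma> \<subseteq> V"
    using assms(2) in_diffD[of _ "fst t" "reindex \<pi> (fst s)"] by (fastforce simp: monomials_def \<gamma>_def)
  then obtain \<phi> where \<phi>: "realizes \<phi> (\<lambda>(\<alpha>, q). (reindex \<pi> \<alpha> + \<gamma>, q))"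
    using realizes_reindex_add by blast
  show thesis
  proof (rule that[OF \<phi>])
    show "(case s of (\<alpha>, q) \<Rightarrow> (reindex \<pi> \<alpha> + \<gamma>, q)) = t"
      using \<pi> by (auto simp: case_prod_unfold \<gamma>_def prod_eq_iff)
    show "(case s of (\<alpha>, q) \<Rightarrow> (reindex \<pi> \<alpha> + \<gamma>, q)) < (case t of (\<alpha>, q) \<Rightarrow> (reindex \<pi> \<alpha> + \<gamma>, q))"
      if "s < t" for s t
      using that reindex_strict_mono[OF \<pi>(2)] by (auto simp: less_prod_def' case_prod_unfold)
  qed
qed

text \<open>Passing to finitely many monomials provides a largest one, where the reduction can
  start.\<close>

lemma span_finite_monomials:
  assumes "x \<in> fa.span (e ` A \<union> K)"
  shows "\<exists>T\<subseteq>A. finite T \<and> x \<in> fa.span (e ` T \<union> K)"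
  using assms
proof (induction rule: fa.span_induct_alt)
  case base
  show ?case by (intro exI[of _ "{}"]) (auto intro: fa.span_zero)
next
  case (step c b y)
  then obtain T where T: "T \<subseteq> A" "finite T" "y \<in> fa.span (e ` T \<union> K)" by blast
  obtain T' where T': "T' \<subseteq> A" "finite T'" "b \<in> fa.span (e ` T' \<union> K)"
  proof (cases "b \<in> K")
    case True
    then show thesis using that[of "{}"] by (auto intro: fa.span_base)
  next
    case False
    then obtain s where "s \<in> A" "b = e s" using step(1) by auto
    then show thesis using that[of "{s}"] by (auto intro: fa.span_base)
  qed
  have "c *\<^sub>F b + y \<in> fa.span (e ` (T \<union> T') \<union> K)"
    using T(3) T'(3) fa.span_mono[of "e ` T \<union> K" "e ` (T \<union> T') \<union> K"]
      fa.span_mono[of "e ` T' \<union> K" "e ` (T \<union> T') \<union> K"]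
    by (intro fa.span_add fa.span_scale) blast+
  then show ?case using T T' by (intro exI[of _ "T \<union> T'"]) auto
qed

text \<open>Cohen's theorem: reduction of leading monomials with respect to finitely many elements.\<close>

theorem multilinear_finitely_generated:
  assumes J: "T_ideal n J" "K \<subseteq> J"
  shows "\<exists>S. finite S \<and> S \<subseteq> J \<and>
    (\<forall>K'. T_ideal n K' \<longrightarrow> K \<subseteq> K' \<longrightarrow> S \<subseteq> K' \<longrightarrow> J \<inter> fa.span (e ` monomials \<union> K) \<subseteq> K')"
proof -
  \<comment> \<open>The leading monomials of \<open>J\<close>, with coefficient 1. Distinct
    monomials may be dependent modulo \<open>K\<close>, so one element can have several; only
    existence matters.\<close>
  define LM where "LM = {t \<in> monomials. \<exists>x\<in>J. x - e t \<in> lower_span t}"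
  obtain B where B: "B \<subseteq> LM" "finite B" "\<And>t. t \<in> LM \<Longrightarrow> \<exists>b\<in>B. divides b t"
    using finite_basis[of LM divides] divides_wqo by (auto simp: LM_def)
  have "\<forall>b\<in>LM. \<exists>x. x \<in> J \<and> x - e b \<in> lower_span b" by (auto simp: LM_def)
  from bchoice[OF this] obtain f where f: "\<And>b. b \<in> LM \<Longrightarrow> f b \<in> J \<and> f b - e b \<in> lower_span b"
    by blast
  show ?thesis
  proof (intro exI[of _ "f ` B"] conjI allI impI)
    show "finite (f ` B)" using B(2) by simp
    show "f ` B \<subseteq> J" using B(1) f by blast
    fix K' assume K': "T_ideal n K'" "K \<subseteq> K'" "f ` B \<subseteq> K'"
    have KL: "K \<subseteq> lower_span t" for t by (auto simp: lower_span_def intro: fa.span_base)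
    \<comment> \<open>An element of the span uses finitely many monomials, so it is enough to treat
      the elements bounded by a single monomial.\<close>
    have reduce: "x \<in> K'" if "x \<in> J" "T \<subseteq> monomials" "finite T" "x \<in> fa.span (e ` T \<union> K)"
      "\<And>s y. s \<in> T \<Longrightarrow> y \<in> J \<Longrightarrow> y \<in> fa.span (e ` {r \<in> monomials. r \<le> s} \<union> K) \<Longrightarrow> y \<in> K'" for x T
    proof (cases "T = {}")
      case True
      then have "x \<in> K"
        using that(4) fa.span_minimal[OF order_refl T_ideal_subspace[OF K]] by auto
      then show ?thesis using K' by blast
    next
      case False
      have "T \<subseteq> {r \<in> monomials. r \<le> Max T}" using that(2,3) by auto
      then have "e ` T \<union> K \<subseteq> e ` {r \<in> monomials. r \<le> Max T} \<union> K" by blast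
      from fa.span_mono[OF this] have "x \<in> fa.span (e ` {r \<in> monomials. r \<le> Max T} \<union> K)"
        using that(4) by blast
      then show ?thesis by (rule that(5)[OF Max_in[OF that(3) False] that(1)])
    qed
    \<comment> \<open>Well-founded induction on the bound \<open>s\<close>: the term at
      \<open>s\<close> is cancelled by an element lying in both \<open>J\<close> and
      \<open>K'\<close>.\<close>
    have main: "x \<in> K'" if "x \<in> J" "x \<in> fa.span (e ` {r \<in> monomials. r \<le> s} \<union> K)" "s \<in> monomials" for x s
      using that
    proof (induction s arbitrary: x rule: less_induct)
      case (less s)
      have low: "y \<in> K'" if y: "y \<in> J" "y \<in> lower_span s" for y
      proof -
        obtain T where T: "T \<subseteq> {r \<in> monomials. r < s}" "finite T" "y \<in> fa.span (e ` T \<union> K)"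
          using span_finite_monomials[OF y(2)[unfolded lower_span_def]] by blast
        show ?thesis
          by (rule reduce[OF y(1) _ T(2,3)]) (use T(1) less.IH in auto)
      qed
      have "{r \<in> monomials. r \<le> s} = insert s {r \<in> monomials. r < s}"
        using less.prems by auto
      then have "x \<in> fa.span (insert (e s) (e ` {r \<in> monomials. r < s} \<union> K))"
        using less.prems by simp
      \<comment> \<open>A possible coefficient of \<open>e s\<close> in \<open>x\<close>; if it is
        0, only smaller monomials remain.\<close>
      then obtain c where c: "x - c *\<^sub>F e s \<in> lower_span s"
        by (auto simp: fa.span_breakdown_eq lower_span_def)
      show ?case
      proof (cases "c = 0")
        case True
        then show ?thesis using low c less.prems by simp
      next
        case False
        have "inverse c *\<^sub>F (x - c *\<^sub>F e s) \<in> lower_span s"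
          using c unfolding lower_span_def by (rule fa.span_scale)
        then have "inverse c *\<^sub>F x - e s \<in> lower_span s"
          using False by (simp add: fa.scale_right_diff_distrib)
        then have "s \<in> LM"
          using less.prems T_ideal_scale[OF J(1)] by (auto simp: LM_def)
        then obtain b where b: "b \<in> B" "divides b s" using B(3) by blast
        obtain \<phi> a where a: "realizes \<phi> a" "a b = s" "\<And>s t. s < t \<Longrightarrow> a s < a t"
          using divides_realizes[OF b(2) less.prems(3)] by blast
        have bm: "b \<in> monomials" "b \<in> LM" using b(1) B(1) by (auto simp: LM_def)
        have lin: "linear_operator \<phi>" using a(1) by (simp add: realizes_def)
        have fb: "f b \<in> J" "f b \<in> K'" "f b - e b \<in> lower_span b" "f b \<in> freeLie n"
          using f[OF bm(2)] K'(3) b(1) T_ideal_subset[OF J(1)] by auto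
        \<comment> \<open>The operator carrying \<open>b\<close> to \<open>s\<close> turns the
          chosen generator \<open>f b\<close> into an element with leading monomial
          \<open>s\<close>.\<close>
        have "\<phi> (f b - e b) \<in> lower_span s"
          using realizes_lower_span[OF a(1) bm(1) a(3) fb(3)] a(2) by simp
        then have "\<phi> (f b) - \<phi> (e b) \<in> lower_span s"
          using linear_operator_diff[OF lin fb(4) e_freeLie[OF bm(1)]] by simp
        moreover have "\<phi> (e b) - e s \<in> lower_span s"
          using a(1,2) bm(1) subsetD[OF KL[of s]] by (auto simp: realizes_def)
        ultimately have "(\<phi> (f b) - \<phi> (e b)) + (\<phi> (e b) - e s) \<in> lower_span s"
          unfolding lower_span_def by (rule fa.span_add)
        then have "c *\<^sub>F (\<phi> (f b) - e s) \<in> lower_span s"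
          unfolding lower_span_def by (intro fa.span_scale) simp
        with c have "(x - c *\<^sub>F e s) - c *\<^sub>F (\<phi> (f b) - e s) \<in> lower_span s"
          unfolding lower_span_def by (rule fa.span_diff)
        then have "x - c *\<^sub>F \<phi> (f b) \<in> lower_span s"
          by (simp add: fa.scale_right_diff_distrib)
        moreover have "\<phi> (f b) \<in> J" "\<phi> (f b) \<in> K'"
          using lin J(1) K'(1) fb(1,2) by (auto simp: linear_operator_def)
        ultimately have "x - c *\<^sub>F \<phi> (f b) \<in> K'"
          using less.prems(1) by (intro low T_ideal_diff[OF J(1)] T_ideal_scale[OF J(1)])
        with \<open>\<phi> (f b) \<in> K'\<close> have "(x - c *\<^sub>F \<phi> (f b)) + c *\<^sub>F \<phi> (f b) \<in> K'"
          by (intro T_ideal_add[OF K'(1)] T_ideal_scale[OF K'(1)])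
        then show ?thesis by simp
      qed
    qed
    show "J \<inter> fa.span (e ` monomials \<union> K) \<subseteq> K'"
    proof
      fix x assume x: "x \<in> J \<inter> fa.span (e ` monomials \<union> K)"
      then obtain T where T: "T \<subseteq> monomials" "finite T" "x \<in> fa.span (e ` T \<union> K)"
        using span_finite_monomials by blast
      show "x \<in> K'"
        by (rule reduce[OF _ T]) (use x T main in auto)
    qed
  qed
qed

end

section \<open>Generation by finitely many multilinear identities\<close>

lemma fa_bracket_vars: "fa_bracket (fa_var a) (fa_var b) = mon [a, b] - mon [b, a]"
  by (simp add: fa_bracket_eq fa_mult_mon flip: mon_single)

lemma meval_bracket_vars:
  assumes "a \<noteq> b"
  shows "meval n \<phi> (fa_bracket (fa_var a) (fa_var b)) i j = word_eval n \<phi> [a, b] i j - word_eval n \<phi> [b, a] i j"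
proof -
  have "{w. fa_bracket (fa_var a) (fa_var b) w \<noteq> (0 :: 'a)} = {[a, b], [b, a]}"
    using assms by (auto simp: fa_bracket_vars fa_apply mon_def)
  then show ?thesis
    unfolding meval_def using assms by (simp add: fa_bracket_vars fa_apply mon_def)
qed

text \<open>The evaluation ends with the truncated identity matrix, which cuts off the columns from
  \<open>n\<close> on.\<close>

lemma word_eval_two:
  "word_eval n \<phi> [a, b] i j = (if j < n then \<Sum>k<n. \<phi> a i k * \<phi> b k j else 0)"
proof -
  have "mmult n A (mone n) k j = (if j < n then A k j else 0)" for A :: "'a mat" and k
  proof -
    have "mmult n A (mone n) k j = (\<Sum>l<n. if l = j then A k l else 0)"
      unfolding mmult_def mone_def by (intro sum.cong) auto
    then show ?thesis by simp
  qed
  then show ?thesis by (simp add: word_eval_def mmult_def[of n "\<phi> a"])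
qed

text \<open>Matrices of degree 0 are diagonal, and diagonal matrices commute.\<close>

lemma y_comm_IdUT:
  assumes "n \<ge> 1"
  shows "fa_bracket (fa_var (0, 0)) (fa_var (0, 1)) \<in> IdUT n"
proof -
  have "word_eval n \<phi> [a, b] i j = word_eval n \<phi> [b, a] i j"
    if "UT_comp n 0 (\<phi> a)" "UT_comp n 0 (\<phi> b)" for \<phi> :: "var \<Rightarrow> 'a mat" and a b i j
  proof -
    have "\<phi> a i k * \<phi> b k j = \<phi> b i k * \<phi> a k j" for k
    proof (cases "i = k \<and> k = j")
      case False
      then have zero: "\<phi> x i k * \<phi> y k j = 0" if "UT_comp n 0 (\<phi> x)" "UT_comp n 0 (\<phi> y)" for x y
        using that unfolding UT_comp_def by (metis add_0_right mult_eq_0_iff)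
      show ?thesis unfolding zero[OF that] zero[OF that(2,1)] ..
    qed simp
    then show ?thesis by (simp add: word_eval_two)
  qed
  then show ?thesis
    using assms
    by (auto simp: IdUT_def graded_identity_def meval_bracket_vars intro!: freeLie.bracket freeLie.gen)
qed

text \<open>In either order of the factors, a nonzero entry of the product would lie at least
  \<open>n\<close> places to the right of the diagonal.\<close>

lemma z_nilp_IdUT:
  assumes "g < n" "h < n" "n \<le> g + h"
  shows "fa_bracket (fa_var (g, 0)) (fa_var (h, 1)) \<in> IdUT n"
proof -
  have "word_eval n \<phi> [a, b] i j = 0"
    if "UT_comp n x (\<phi> a)" "UT_comp n y (\<phi> b)" "n \<le> x + y" for \<phi> :: "var \<Rightarrow> 'a mat" and a b i j x y
  proof -
    have "\<phi> a i k * \<phi> b k j = 0" for k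
    proof (rule ccontr)
      assume "\<phi> a i k * \<phi> b k j \<noteq> 0"
      then have "k = i + x" "j = k + y" "j < n" using that unfolding UT_comp_def by force+
      then show False using that(3) by simp
    qed
    then show ?thesis by (simp add: word_eval_two del: mult_eq_0_iff)
  qed
  note * = this
  have "meval n \<phi> (fa_bracket (fa_var (g, 0)) (fa_var (h, 1))) i j = 0"
    if "\<forall>g i. g < n \<longrightarrow> UT_comp n g (\<phi> (g, i))" for \<phi> :: "var \<Rightarrow> 'a mat" and i j
    using that assms *[of g \<phi> "(g, 0)" h "(h, 1)"] *[of h \<phi> "(h, 1)" g "(g, 0)"]
    by (simp add: meval_bracket_vars add.commute)
  then show ?thesis
    using assms by (auto simp: IdUT_def graded_identity_def intro!: freeLie.bracket freeLie.gen)
qed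

definition base_identities :: "nat \<Rightarrow> 'f::field fa set" where
  "base_identities n = insert (fa_bracket (fa_var (0, 0)) (fa_var (0, 1)))
     ((\<lambda>(g, h). fa_bracket (fa_var (g, 0)) (fa_var (h, 1))) `
       {(g, h). 0 < g \<and> g < n \<and> 0 < h \<and> h < n \<and> n \<le> g + h})"

lemma finite_base_identities: "finite (base_identities n)"
proof -
  have "finite {(g, h). 0 < g \<and> g < n \<and> 0 < h \<and> h < n \<and> n \<le> g + h}"
    by (rule finite_subset[of _ "{..<n} \<times> {..<n}"]) auto
  then show ?thesis by (simp add: base_identities_def)
qed

lemma base_identities_IdUT: "n \<ge> 1 \<Longrightarrow> base_identities n \<subseteq> IdUT n"
  using y_comm_IdUT z_nilp_IdUT by (auto simp: base_identities_def)

lemma base_idealI: "n \<ge> 1 \<Longrightarrow> T_ideal n K \<Longrightarrow> base_identities n \<subseteq> K \<Longrightarrow> base_ideal n K"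
  by unfold_locales (simp_all add: base_identities_def image_subset_iff)

section \<open>Finitely many multilinear degrees suffice\<close>

abbreviation indic :: "var set \<Rightarrow> var \<Rightarrow> nat" where
  "indic V \<equiv> (\<lambda>v. if v \<in> V then 1 else 0)"

lemma count_list_map_eq:
  assumes "\<And>x. x \<in> set w \<Longrightarrow> \<rho> x = v \<longleftrightarrow> x = u"
  shows "count_list (map \<rho> w) v = count_list w u"
  using assms by (induction w) auto

text \<open>Numbering \<open>V\<close> from 0 puts all indices below \<open>card V\<close>, hence
  below \<open>n\<close>, so only subsets of a fixed finite box remain; the inverse renaming
  recovers \<open>p\<close> from \<open>q\<close>.\<close>

lemma rename_multilinear:
  assumes J: "T_ideal n J" and V: "finite V" "card V < n" "\<And>v. v \<in> V \<Longrightarrow> 0 < fst v \<and> fst v < n"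
    and p: "p \<in> J" "degree_on zdeg (indic V) p"
  obtains W q where "W \<subseteq> {0<..<n} \<times> {..<n}" "W = {} \<longleftrightarrow> V = {}" "q \<in> J" "degree_on zdeg (indic W) q"
    "\<forall>K. T_ideal n K \<longrightarrow> q \<in> K \<longrightarrow> p \<in> K"
proof -
  obtain h where h: "bij_betw h V {0..<card V}" using ex_bij_betw_finite_nat[OF V(1)] by blast
  define \<rho> where "\<rho> v = (if v \<in> V then (fst v, h v) else v)" for v
  define W where "W = \<rho> ` V"
  define \<rho>' where "\<rho>' v = (if v \<in> W then inv_into V \<rho> v else v)" for v
  have inj: "inj_on \<rho> V"
    using h by (auto simp: inj_on_def \<rho>_def bij_betw_def)
  have fst\<rho>: "fst (\<rho> v) = fst v" for v by (simp add: \<rho>_def)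
  have inv: "\<rho>' (\<rho> v) = v" if "v \<in> V" for v
    using that inj by (simp add: \<rho>'_def W_def)
  have fst\<rho>': "fst (\<rho>' v) = fst v" for v
    using inv fst\<rho> by (auto simp: \<rho>'_def[of v] W_def) (metis W_def \<rho>'_def fst\<rho> imageI inv)
  have W: "W \<subseteq> {0<..<n} \<times> {..<n}"
  proof
    fix w assume "w \<in> W"
    then obtain v where v: "v \<in> V" "w = (fst v, h v)" by (auto simp: W_def \<rho>_def)
    then have "h v < card V" using h by (auto simp: bij_betw_def)
    then show "w \<in> {0<..<n} \<times> {..<n}" using v V(2) V(3)[OF v(1)] by simp
  qed
  have pL: "p \<in> freeLie n" using p(1) T_ideal_subset[OF J] by blast
  \<comment> \<open>\<rho> may collide with letters outside \<open>V\<close>, but the only such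
    letters in \<open>p\<close> are y's, which stay fixed.\<close>
  have letters: "x \<in> V \<or> fst x = 0" if "p w \<noteq> 0" "x \<in> set w" for w x
  proof (rule ccontr)
    assume "\<not> (x \<in> V \<or> fst x = 0)"
    moreover have "zdeg w = indic V" using p(2) that(1) by (auto simp: degree_on_def)
    from fun_cong[OF this, of x] have "zdeg w x = indic V x" .
    ultimately show False using that(2) by (auto simp: zdeg_def count_list_0_iff)
  qed
  have \<sigma>: "graded_endo n (\<lambda>v. fa_var (\<rho> v) :: 'a fa)" "graded_endo n (\<lambda>v. fa_var (\<rho>' v) :: 'a fa)"
    by (auto intro!: graded_endo_rename simp: fst\<rho> fst\<rho>')
  define q where "q = fsubst (\<lambda>v. fa_var (\<rho> v)) p"
  have q: "q \<in> J" unfolding q_def by (intro T_ideal_subst[OF J p(1)] \<sigma>)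
  have "degree_on zdeg (indic W) q"
    unfolding degree_on_def
  proof (intro allI impI)
    fix u assume "q u \<noteq> 0"
    then have "(\<Sum>w\<in>supp p. p w * mon (map \<rho> w) u) \<noteq> 0"
      by (simp add: q_def fsubst_superset[OF finite_supp_freeLie[OF pL] order_refl] sum_fa_apply fa_apply word_prod_rename)
    then obtain w where w: "p w \<noteq> 0" "u = map \<rho> w"
      by (metis (no_types, lifting) mon_def mult_not_zero sum.not_neutral_contains_not_neutral)
    have zw: "zdeg w = indic V" using p(2) w(1) by (auto simp: degree_on_def)
    show "zdeg u = indic W"
    proof
      fix v
      show "zdeg u v = indic W v"
      proof (cases "v \<in> W")
        case True
        then obtain x where x: "x \<in> V" "v = \<rho> x" by (auto simp: W_def)
        have x0: "fst x \<noteq> 0" using V(3)[OF x(1)] by simp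
        have "count_list u v = count_list w x"
          unfolding w(2)
        proof (rule count_list_map_eq)
          fix y assume "y \<in> set w"
          from letters[OF w(1) this] show "(\<rho> y = v) = (y = x)"
            using x x0 inj fst\<rho>[of x] fst\<rho>[of y] by (auto simp: inj_on_def)
        qed
        also have "\<dots> = 1" using fun_cong[OF zw, of x] x x0 by (simp add: zdeg_def)
        finally show ?thesis using True x x0 fst\<rho> by (simp add: zdeg_def)
      next
        case False
        have "v \<notin> set u" if "fst v \<noteq> 0"
        proof
          assume "v \<in> set u"
          then obtain y where y: "y \<in> set w" "v = \<rho> y" using w(2) by auto
          then have "y \<in> V" using letters[OF w(1) y(1)] that fst\<rho>[of y] by auto
          then show False using False y(2) by (simp add: W_def)
        qed
        then show ?thesis using False by (simp add: zdeg_def count_list_0_iff)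
      qed
    qed
  qed
  moreover have "p = fsubst (\<lambda>v. fa_var (\<rho>' v)) q"
    unfolding q_def fsubst_fsubst[OF pL \<sigma>(1)]
  proof (rule fsubst_id[symmetric])
    show "finite (supp p)" using pL by simp
    fix w v assume "p w \<noteq> 0" "v \<in> set w"
    from letters[OF this] have "\<rho>' (\<rho> v) = v"
    proof
      assume "fst v = 0"
      then have "v \<notin> V" "v \<notin> W" using V(3)[of v] W by auto
      then show ?thesis by (simp add: \<rho>_def \<rho>'_def)
    qed (use inv in auto)
    then show "fsubst (\<lambda>v. fa_var (\<rho>' v)) (fa_var (\<rho> v)) = (fa_var v :: 'a fa)" by simp
  qed
  then have "p \<in> K" if "T_ideal n K" "q \<in> K" for K
    using T_ideal_subst[OF that \<sigma>(2)] by simp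
  ultimately show thesis
    using that[OF W _ q] by (simp add: W_def)
qed

text \<open>Restated without the monomials of the locale, which depend on \<open>V\<close>, so that
  all choices of \<open>V\<close> can be combined.\<close>

lemma multilinear_generators:
  fixes K J :: "'f::field fa set"
  assumes inf: "infinite (UNIV :: 'f set)"
    and K: "base_ideal n K" and J: "T_ideal n J" "K \<subseteq> J"
    and V: "V \<subseteq> {0<..<n} \<times> {..<n}" "V \<noteq> {}"
  shows "\<exists>S. finite S \<and> S \<subseteq> J \<and>
    (\<forall>K'. T_ideal n K' \<longrightarrow> K \<subseteq> K' \<longrightarrow> S \<subseteq> K' \<longrightarrow> (\<forall>p\<in>J. degree_on zdeg (indic V) p \<longrightarrow> p \<in> K'))"
proof -
  have fV: "finite V" using V(1) finite_subset by blast
  have "finite {s. distinct s \<and> set s = V}"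
    by (rule finite_subset[OF _ finite_lists_length_eq[OF fV, of "card V"]]) (auto simp: distinct_card)
  from finite_list[OF this] obtain ps where ps: "set ps = {s. distinct s \<and> set s = V}" ..
  interpret multilinear_part n K V ps
    using K fV V ps by (intro multilinear_part.intro multilinear_part_axioms.intro) auto
  obtain S where S: "finite S" "S \<subseteq> J"
    "\<And>K'. T_ideal n K' \<Longrightarrow> K \<subseteq> K' \<Longrightarrow> S \<subseteq> K' \<Longrightarrow> J \<inter> fa.span (e ` monomials \<union> K) \<subseteq> K'"
    using multilinear_finitely_generated[OF J] by blast
  have "p \<in> fa.span (e ` monomials \<union> K)" if "p \<in> J" "degree_on zdeg (indic V) p" for p
    using multilinear_span[OF inf _ that(2)] T_ideal_subset[OF J(1)] that(1) by blast
  with S show ?thesis by (intro exI[of _ S]) blast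
qed

text \<open>All brackets of multidegree \<open>m\<close> have as total degree the sum over
  \<open>A\<close>, so they lie in \<open>K\<close>; no y_i contributes, as the sum is
  positive.\<close>

lemma (in base_ideal) homogeneous_degree_ge:
  assumes inf: "infinite (UNIV :: 'f set)" and p: "p \<in> freeLie n" "degree_on zdeg m p"
    and fin: "finite A" "{v. m v \<noteq> 0} \<subseteq> A" and ge: "n \<le> (\<Sum>v\<in>A. m v * fst v)"
  shows "p \<in> K"
proof -
  have "zy_bracket t \<in> K" if t: "t \<in> zy_terms n" "zdeg (map fst t) = m" for t
  proof (rule zy_bracket_degree_ge[OF t(1)])
    have cnt: "count_list (map fst t) v * fst v = m v * fst v" for v
      using fun_cong[OF t(2), of v] by (auto simp: zdeg_def split: if_splits)
    have "sum_list (map fst (map fst t)) = (\<Sum>v\<in>set (map fst t). m v * fst v)"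
      unfolding sum_list_map_eq_sum_count cnt ..
    also have "\<dots> = (\<Sum>v\<in>A. m v * fst v)"
    proof (rule sum.mono_neutral_cong[OF fin(1)])
      show "m v * fst v = 0" if "v \<in> A - set (map fst t)" for v
        using that cnt[of v] by (metis DiffE count_list_0_iff mult_eq_0_iff)
      show "m v * fst v = 0" if "v \<in> set (map fst t) - A" for v
        using that fin(2) by auto
    qed auto
    finally show "n \<le> sum_list (map (\<lambda>x. fst (fst x)) t)"
      using ge by (simp add: o_def)
  qed
  moreover have "m \<noteq> 0"
  proof
    assume "m = 0"
    then show False using ge n by (simp add: fa_apply)
  qed
  ultimately have "(if m = 0 then range y_var else {}) \<union>
      zy_bracket ` {t \<in> zy_terms n. zdeg (map fst t) = m} \<union> K \<subseteq> K"
    by auto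
  from fa.span_minimal[OF this T_ideal_subspace[OF K]] homogeneous_span[OF inf p] show ?thesis by blast
qed

text \<open>Modulo \<open>K\<close>, multidegree 0 consists of the linear combinations of y's. From
  a nonzero combination in \<open>J\<close> one extracts some y_i as its part of degree 1 in y_i,
  and renaming then gives all y's.\<close>

lemma (in base_ideal) degree_zero_generated:
  assumes inf: "infinite (UNIV :: 'f set)" and J: "T_ideal n J" "K \<subseteq> J"
    and p: "p \<in> J" "degree_on zdeg 0 p" and K': "T_ideal n K'" "K \<subseteq> K'" "y_var 0 \<in> J \<Longrightarrow> y_var 0 \<in> K'"
  shows "p \<in> K'"
proof -
  have none: "{t \<in> zy_terms n. zdeg (map fst t) = 0} = {}"
  proof -
    have False if t: "t \<in> zy_terms n" "zdeg (map fst t) = 0" for t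
    proof -
      obtain x where x: "x \<in> set t" using t(1) by (cases t) (auto simp: zy_terms_def)
      then have "0 < fst (fst x)" "fst x \<in> set (map fst t)" using t(1) by (auto simp: zy_terms_def)
      then show False using fun_cong[OF t(2), of "fst x"] by (simp add: zdeg_def fa_apply count_list_0_iff)
    qed
    then show ?thesis by blast
  qed
  have "p \<in> fa.span (range y_var \<union> K)"
    using homogeneous_span[OF inf _ p(2), unfolded none] T_ideal_subset[OF J(1)] p(1) by auto
  then obtain x y where xy: "p = x + y" "x \<in> fa.span (range y_var)" "y \<in> fa.span K"
    unfolding fa.span_Un by blast
  have y: "y \<in> K" using xy(3) fa.span_minimal[OF order_refl T_ideal_subspace[OF K]] by blast
  then have xJ: "x \<in> J" using T_ideal_diff[OF J(1) p(1), of y] J(2) xy(1) by auto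
  have xw: "\<exists>i. w = [(0, i)]" if "x w \<noteq> 0" for w
    using xy(2) that
  proof (induction arbitrary: w rule: fa.span_induct_alt)
    case base
    then show ?case by (simp add: fa_apply)
  next
    case (step c b z)
    then have "b w \<noteq> 0 \<or> z w \<noteq> 0" by (auto simp: fa_apply)
    with step show ?case by (auto simp: y_var_def fa_var_def split: if_splits)
  qed
  have "x \<in> K'"
  proof (cases "x = 0")
    case True
    then show ?thesis using T_ideal_zero[OF K'(1)] by simp
  next
    case False
    then obtain w where w: "x w \<noteq> 0" by (auto simp: fun_eq_iff fa_apply)
    then obtain i where i: "w = [(0, i)]" using xw by blast
    have "count_part (0, i) 1 x = x w *\<^sub>F y_var i"
    proof
      fix u
      show "count_part (0, i) 1 x u = (x w *\<^sub>F y_var i) u"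
        using xw[of u] by (cases "x u = 0") (auto simp: count_part_def fa_apply y_var_def fa_var_def i split: if_splits)
    qed
    with T_ideal_count_part[OF inf J(1) xJ, of "(0, i)" 1] have "x w *\<^sub>F y_var i \<in> J" by simp
    from T_ideal_scale[OF J(1) this, of "inverse (x w)"] have yi: "y_var i \<in> J" using w by simp
    have ren: "y_var k \<in> I" if "T_ideal n I" "y_var j \<in> I" for I :: "'f fa set" and j k
    proof -
      have "fsubst (\<lambda>v. fa_var (if fst v = 0 then (0, k) else v)) (y_var j) \<in> I"
        by (intro T_ideal_subst[OF that] graded_endo_rename) auto
      then show ?thesis by (simp add: y_var_def)
    qed
    have "y_var 0 \<in> K'" using K'(3) ren[OF J(1) yi] by blast
    then have "range y_var \<subseteq> K'" using ren[OF K'(1)] by blast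
    from fa.span_minimal[OF this T_ideal_subspace[OF K'(1)]] xy(2) show ?thesis by blast
  qed
  then show ?thesis using xy(1) y K'(2) T_ideal_add[OF K'(1)] by blast
qed

theorem mainTheorem1:
  fixes n :: nat
  assumes "n \<ge> 1"
    and "infinite (UNIV :: 'f::field set)"
    and "CHAR('f) = 0 \<or> CHAR('f) \<ge> n"
  shows "\<forall>J :: 'f fa set. T_ideal n J \<and> IdUT n \<subseteq> J \<longrightarrow>
           (\<exists>S. finite S \<and> S \<subseteq> J \<and> J = T_gen n S)"
proof (intro allI impI)
  fix J :: "'f fa set"
  assume "T_ideal n J \<and> IdUT n \<subseteq> J"
  then have J: "T_ideal n J" and idJ: "base_identities n \<subseteq> J"
    using base_identities_IdUT[OF assms(1)] by auto
  \<comment> \<open>Normal forms are taken modulo \<open>K0\<close>; the later \<open>K\<close> is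
    the T-ideal of the candidate generators \<open>G\<close>.\<close>
  define K0 :: "'f fa set" where "K0 = T_gen n (base_identities n)"
  have K0: "T_ideal n K0" "base_identities n \<subseteq> K0" "K0 \<subseteq> J"
    unfolding K0_def using T_ideal_T_gen[OF J idJ] T_gen_superset T_gen_least[OF J idJ] by auto
  interpret K0: base_ideal n K0 by (rule base_idealI[OF assms(1) K0(1,2)])
  \<comment> \<open>Up to renaming, only these sets of z's occur in the multilinear case; the empty
    set belongs to multidegree 0.\<close>
  define Vs where "Vs = Pow ({0<..<n} \<times> {..<n}) - {{}}"
  define generates where "generates V S \<longleftrightarrow> finite S \<and> S \<subseteq> J \<and>
    (\<forall>K'. T_ideal n K' \<longrightarrow> K0 \<subseteq> K' \<longrightarrow> S \<subseteq> K' \<longrightarrow> (\<forall>p\<in>J. degree_on zdeg (indic V) p \<longrightarrow> p \<in> K'))"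
    for V S
  have "\<forall>V\<in>Vs. \<exists>S. generates V S"
    unfolding Vs_def generates_def
    by (intro ballI multilinear_generators[OF assms(2) K0.base_ideal_axioms J K0(3)]) auto
  from bchoice[OF this] obtain S where "\<forall>V\<in>Vs. generates V (S V)" ..
  then have S: "finite (S V)" "S V \<subseteq> J" "generates V (S V)" if "V \<in> Vs" for V
    using that by (auto simp: generates_def)
  \<comment> \<open>The element \<open>y_var 0\<close>, present only if \<open>J\<close> contains
    it, takes care of multidegree 0.\<close>
  define G where "G = base_identities n \<union> ({y_var 0} \<inter> J) \<union> (\<Union>V\<in>Vs. S V)"
  have G: "finite G" "G \<subseteq> J"
    using S(1,2) idJ by (auto simp: G_def Vs_def finite_base_identities)
  define K where "K = T_gen n G"
  have K: "T_ideal n K" "G \<subseteq> K" "K \<subseteq> J"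
    unfolding K_def using T_ideal_T_gen[OF J G(2)] T_gen_superset T_gen_least[OF J G(2)] by auto
  have K0K: "K0 \<subseteq> K"
    unfolding K0_def by (rule T_gen_least[OF K(1)]) (use K(2) in \<open>auto simp: G_def\<close>)
  have multilinear: "p \<in> K" if "V \<in> Vs" "p \<in> J" "degree_on zdeg (indic V) p" for V p
  proof -
    have "S V \<subseteq> K" using that(1) K(2) by (auto simp: G_def)
    then show ?thesis using S(3)[OF that(1)] that(2,3) K(1) K0K by (simp add: generates_def)
  qed
  \<comment> \<open>Induction on the excess of \<open>m\<close> over multilinearity, which every
    linearization lowers.\<close>
  have homogeneous: "p \<in> K" if "p \<in> J" "degree_on zdeg m p" for m p
    using that
  proof (induction "\<Sum>v | m v \<noteq> 0. m v - 1" arbitrary: m p rule: less_induct)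
    case less
    define A where "A = {v. m v \<noteq> 0}"
    have pL: "p \<in> freeLie n" using less.prems(1) T_ideal_subset[OF J] by blast
    show ?case
    proof (cases "p = 0 \<or> m = 0")
      case True
      then show ?thesis
      proof
        assume "p = 0"
        then show ?thesis using T_ideal_zero[OF K(1)] by simp
      next
        assume "m = 0"
        then show ?thesis
          using K0.degree_zero_generated[OF assms(2) J K0(3) less.prems(1) _ K(1) K0K] less.prems(2) K(2)
          by (auto simp: G_def)
      qed
    next
      case False
      then obtain w where w: "p w \<noteq> 0" by (auto simp: fun_eq_iff fa_apply)
      then have zw: "zdeg w = m" using less.prems(2) by (auto simp: degree_on_def)
      have Aw: "v \<in> set w \<and> 0 < fst v" if "v \<in> A" for v
        using that unfolding A_def zw[symmetric]
        by (auto simp: zdeg_def split: if_splits) (metis count_list_0_iff less_irrefl)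
      have A: "finite A" "\<And>v. v \<in> A \<Longrightarrow> 0 < fst v \<and> fst v < n"
        using Aw freeLie_letters[OF pL w] by (auto intro: finite_subset[of A "set w"])
      show ?thesis
      \<comment> \<open>Total degree \<open>n\<close> or more is absorbed by \<open>K0\<close>.
        Below \<open>n\<close>, the number of z's and their multiplicities are also below
        \<open>n\<close>.\<close>
      proof (cases "n \<le> (\<Sum>v\<in>A. m v * fst v)")
        case True
        then have "p \<in> K0"
          by (intro K0.homogeneous_degree_ge[OF assms(2) pL less.prems(2) A(1)]) (auto simp: A_def)
        then show ?thesis using K0K by blast
      next
        case small: False
        show ?thesis
        proof (cases "\<exists>z\<in>A. m z \<ge> 2")
          case False
          have m1: "m v = 1" if "v \<in> A" for v
          proof -
            have "\<not> 2 \<le> m v" using False that by blast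
            moreover have "m v \<noteq> 0" using that by (simp add: A_def)
            ultimately show ?thesis by linarith
          qed
          then have mA: "m = indic A" by (auto simp: A_def fun_eq_iff)
          have "card A \<le> (\<Sum>v\<in>A. m v * fst v)"
            using sum_mono[of A "\<lambda>_. 1" "\<lambda>v. m v * fst v"] A(2) m1 by force
          then have cA: "card A < n" using small by simp
          have "A \<noteq> {}"
          proof
            assume "A = {}"
            then have "m = 0" by (auto simp: A_def fun_eq_iff fa_apply)
            with \<open>\<not> (p = 0 \<or> m = 0)\<close> show False by simp
          qed
          obtain W q where q: "W \<subseteq> {0<..<n} \<times> {..<n}" "W = {} \<longleftrightarrow> A = {}" "q \<in> J"
            "degree_on zdeg (indic W) q" "\<forall>K. T_ideal n K \<longrightarrow> q \<in> K \<longrightarrow> p \<in> K"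
            by (rule rename_multilinear[OF J A(1) cA A(2) less.prems(1) less.prems(2)[unfolded mA]]) (assumption, rule that)
          have "W \<in> Vs" using q(1,2) \<open>A \<noteq> {}\<close> by (auto simp: Vs_def)
          then show ?thesis using multilinear q(3-5) K(1) by blast
        next
          case True
          then obtain z where z: "z \<in> A" "m z \<ge> 2" by blast
          \<comment> \<open>As z's have degree at least 1, the multiplicity of \<open>z\<close> is
            at most the total degree. Being positive and below \<open>n\<close>, it is invertible by
            the assumption on the characteristic.\<close>
          have "m z * 1 \<le> m z * fst z" using A(2)[OF z(1)] by (intro mult_le_mono) auto
          also have "\<dots> \<le> (\<Sum>v\<in>A. m v * fst v)" using z(1) A(1) by (intro member_le_sum) auto
          finally have mz: "m z < n" using small by simp
          have d: "(of_nat (m z) :: 'f) \<noteq> 0"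
          proof
            assume "(of_nat (m z) :: 'f) = 0"
            then have "CHAR('f) dvd m z" by (simp add: of_nat_eq_0_iff_char_dvd)
            then show False using assms(3) mz z(2) by (auto dest: dvd_imp_le)
          qed
          have "finite (snd ` A)" using A(1) by simp
          then obtain k where k: "k \<notin> snd ` A" using ex_new_if_finite[OF infinite_UNIV_nat] by blast
          define t where "t = (fst z, k)"
          have t: "t \<notin> A" "fst t = fst z" "z \<noteq> t"
            using k z(1) by (auto simp: t_def image_iff) (metis snd_conv)+
          have mt: "m t = 0" using t(1) by (simp add: A_def)
          obtain q where q: "q \<in> J" "degree_on zdeg (m(z := m z - 1, t := 1)) q"
            "\<And>K. T_ideal n K \<Longrightarrow> q \<in> K \<Longrightarrow> p \<in> K"
            using T_ideal_linearize[OF assms(2) J less.prems _ t(2) mt t(3) d] A(2)[OF z(1)] by auto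
          let ?m = "m(z := m z - 1, t := 1)"
          have "{v. ?m v \<noteq> 0} = insert t A"
            using z t mt by (auto simp: A_def)
          \<comment> \<open>The new variable \<open>t\<close> adds nothing to the excess, while
            \<open>z\<close>, still present because its multiplicity was at least 2, loses
            1.\<close>
          then have "(\<Sum>v | ?m v \<noteq> 0. ?m v - 1) = (\<Sum>v\<in>insert t A. ?m v - 1)" by simp
          also have "\<dots> = (\<Sum>v\<in>A. ?m v - 1)" using A(1) t by simp
          also have "\<dots> < (\<Sum>v\<in>A. m v - 1)"
          proof (rule sum_strict_mono_ex1[OF A(1)])
            show "\<forall>v\<in>A. ?m v - 1 \<le> m v - 1" using t(1) by auto
            show "\<exists>v\<in>A. ?m v - 1 < m v - 1" using z t(3) by (intro bexI[of _ z]) auto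
          qed
          finally have "q \<in> K"
            using less.hyps[of ?m q] q(1,2) by (simp add: A_def)
          then show ?thesis using q(3) K(1) by blast
        qed
      qed
    qed
  qed
  have "J \<subseteq> K"
  proof
    fix p assume p: "p \<in> J"
    have fin: "finite (supp p)" using p T_ideal_subset[OF J] by auto
    \<comment> \<open>Over an infinite field \<open>J\<close> contains the multihomogeneous
      components of its elements, so the homogeneous case suffices.\<close>
    have "(\<Sum>m\<in>zdeg ` supp p. zdeg_part m p) \<in> K"
      by (intro T_ideal_sum[OF K(1)] homogeneous[OF T_ideal_zdeg_part[OF assms(2) J p] degree_on_zdeg_part])
    then show "p \<in> K" using zdeg_part_decompose[OF fin] by simp
  qed
  then have "J = T_gen n G" using K(3) by (simp add: K_def)
  then show "\<exists>S. finite S \<and> S \<subseteq> J \<and> J = T_gen n S" using G by blast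
qed

end
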